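(* There is a sequence of temperature-1 tile assembly systems $\mathcal{T}_n=(T_n,\sigma_n,1)$, each with a single-tile seed $\sigma_n$ and $|T_n|=n$, and a function $h(n)=2n+o(n)$, such that for every $n$ every terminal assembly $a\in\mathcal{A}_\Box[\mathcal{T}_n]$ is finite and of height $h(n)$.
   Context: Abstract Tile Assembly Model at temperature 1 on $\mathbb{Z}^2$: a tile type is a unit square with a glue label on each of its four sides (north, east, south, west); all glues have strength 1 except a special null glue of strength 0. An assembly is a partial function $\alpha:\mathbb{Z}^2\dashrightarrow T$. Two tiles at adjacent positions interact if the glue labels on their abutting sides are equal and of positive strength. A tile assembly system is $\mathcal{T}=(T,\sigma,1)$ with $T$ a finite set of tile types and $\sigma$ the seed assembly, here consisting of exactly one tile. An assembly $\beta$ is obtained from $\alpha$ in one step if $\beta$ extends $\alpha$ by exactly one tile that interacts with at least one tile of $\alpha$ (mismatching glues on other sides are allowed). The producible assemblies are those obtainable from $\sigma$ by finitely many steps; an assembly is terminal if it is producible and no tile can be added to it; $\mathcal{A}_\Box[\mathcal{T}]$ is the set of terminal assemblies (which may be infinite). The height of a finite assembly is $\max y-\min y+1$ over the positions $(x,y)$ of its domain. *)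

theory Defs
  imports Main "HOL-Library.Landau_Symbols"
begin

text \<open>Glue labels are natural numbers; the label 0 is the null glue (strength 0),
  every other label has strength 1.\<close>

datatype tile = Tile (north: nat) (east: nat) (south: nat) (west: nat)

type_synonym pos = "int \<times> int"
type_synonym assembly = "pos \<Rightarrow> tile option"

definition interacts :: "pos \<Rightarrow> tile \<Rightarrow> pos \<Rightarrow> tile \<Rightarrow> bool" where
  "interacts p t q u \<longleftrightarrow>
     (q = (fst p + 1, snd p) \<and> east t = west u \<and> east t \<noteq> 0) \<or>
     (q = (fst p - 1, snd p) \<and> west t = east u \<and> west t \<noteq> 0) \<or>
     (q = (fst p, snd p + 1) \<and> north t = south u \<and> north t \<noteq> 0) \<or>
     (q = (fst p, snd p - 1) \<and> south t = north u \<and> south t \<noteq> 0)"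

definition attachable :: "tile set \<Rightarrow> assembly \<Rightarrow> pos \<Rightarrow> tile \<Rightarrow> bool" where
  "attachable T \<alpha> p t \<longleftrightarrow> t \<in> T \<and> \<alpha> p = None \<and>
     (\<exists>q u. \<alpha> q = Some u \<and> interacts p t q u)"

definition step :: "tile set \<Rightarrow> assembly \<Rightarrow> assembly \<Rightarrow> bool" where
  "step T \<alpha> \<beta> \<longleftrightarrow> (\<exists>p t. attachable T \<alpha> p t \<and> \<beta> = \<alpha>(p \<mapsto> t))"

definition single_tile_seed :: "tile set \<Rightarrow> assembly \<Rightarrow> bool" where
  "single_tile_seed T \<sigma> \<longleftrightarrow> (\<exists>p t. t \<in> T \<and> \<sigma> = [p \<mapsto> t])"

text \<open>Producible assemblies: results (limits) of assembly sequences starting at the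
  seed; a finite sequence is represented by an eventually stationary one.\<close>
definition producible :: "tile set \<Rightarrow> assembly \<Rightarrow> assembly \<Rightarrow> bool" where
  "producible T \<sigma> \<alpha> \<longleftrightarrow> (\<exists>f :: nat \<Rightarrow> assembly. f 0 = \<sigma> \<and>
      (\<forall>i. f (Suc i) = f i \<or> step T (f i) (f (Suc i))) \<and>
      (\<forall>p. (\<alpha> p = None \<longleftrightarrow> (\<forall>i. f i p = None)) \<and>
           (\<forall>i t. f i p = Some t \<longrightarrow> \<alpha> p = Some t)))"

definition terminal :: "tile set \<Rightarrow> assembly \<Rightarrow> assembly \<Rightarrow> bool" where
  "terminal T \<sigma> \<alpha> \<longleftrightarrow> producible T \<sigma> \<alpha> \<and> \<not> (\<exists>p t. attachable T \<alpha> p t)"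

definition height :: "assembly \<Rightarrow> int" where
  "height \<alpha> = Max (snd ` dom \<alpha>) - Min (snd ` dom \<alpha>) + 1"

end

theory Submission
  imports Defs "HOL-Library.Countable"
begin

text \<open>A tower is a vertical spine of \<open>M\<close> tile types capped by an arch of four tiles, from whose other
  end the same spine grows back down, three columns aside. So the second foot of a tower returns to
  the level of the first one at no cost in tile types. (Whether the arch goes west or east is decided
  by a race for the cell on top of the spine; both outcomes must be, and are, equally good.)
  Below a spine sits a joint, with one exit on each side. The seed chain enters the first joint after
  having blocked both its exits, but leaves open the outer exit of the joint that forms under the
  second foot. From there a chain runs \<open>8 J\<close> columns to the west and starts a ramp with
  period \<open>P\<close> up and 8 to the right, which climbs until it hits the first tower. In each of its \<open>J\<close>
  periods the ramp launches a further tower, through a chain that blocks both exits of the joint and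
  both cells where a second joint could form, so that nothing leaves these towers again. The last one
  starts at height \<open>J P\<close>, hence the total height is \<open>J P + M + 5\<close>, with \<open>58 + M + 8 J + P\<close> tile types;
  now let \<open>J = P\<close> be about \<open>sqrt n\<close>.

  Once the directions of the arches are read off from the terminal assembly, growth is
  deterministic: the assemblies met on the way are exactly the parent-closed subsets of a fixed finite
  tree of placed tiles, because each mismatched glue faces a cell occupied by an ancestor.\<close>

section \<open>The tile types\<close>

datatype dir = North | East | South | West

primrec opp :: "dir \<Rightarrow> dir" where
  "opp North = South" | "opp East = West" | "opp South = North" | "opp West = East"

primrec shift :: "dir \<Rightarrow> pos \<Rightarrow> pos" where
  "shift North p = (fst p, snd p + 1)"
| "shift East p = (fst p + 1, snd p)"
| "shift South p = (fst p, snd p - 1)"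
| "shift West p = (fst p - 1, snd p)"

lemma opp_opp [simp]: "opp (opp d) = d"
  by (cases d) auto

lemma opp_neq [simp]: "opp d \<noteq> d" "d \<noteq> opp d"
  by (cases d; simp)+

lemma opp_eq_iff [simp]: "opp d = opp e \<longleftrightarrow> d = e"
  by (cases d; cases e) auto

lemma shift_opp [simp]: "shift (opp d) (shift d p) = p" "shift d (shift (opp d) p) = p"
  by (cases d; simp)+

datatype fam = Seed_Chain | Launch | Joint | Spine | Arch | Exit_W | Exit_E | Run | Ramp

text \<open>\<open>Inner f i\<close> joins tiles \<open>i\<close> and \<open>i + 1\<close> of chain
  \<open>f\<close>; the named glues other than \<open>Null\<close> serve the junctions between
  chains.\<close>

datatype glue = Null | Eta | Alpha | Beta | Kappa_W | Kappa_E | Omega | Delta | Upsilon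
  | Inner fam nat

instance fam :: countable by countable_datatype
instance glue :: countable by countable_datatype

definition enc :: "glue \<Rightarrow> nat" where
  "enc g = (if g = Null then 0 else Suc (to_nat g))"

lemma enc_eq_iff [simp]: "enc g = enc h \<longleftrightarrow> g = h"
  by (auto simp: enc_def)

lemma enc_eq_0_iff [simp]: "enc g = 0 \<longleftrightarrow> g = Null"
  by (auto simp: enc_def)

type_synonym label = "fam \<times> nat"

definition seed_dirs :: "dir list" where
  "seed_dirs = [West, North, West, South, South, West, West, West, West, North, East, North,
     East, South, East, North]"

definition launch_dirs :: "dir list" where
  "launch_dirs = [North, North, West, West, South, South, West, West, West, West, North, North,
     East, East, South, East, North]"

text \<open>With the first joint at the origin, the path covers both of its exits
  \<open>(1,0)\<close> and \<open>(-1,0)\<close>. For a second foot over \<open>(3,0)\<close> or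
  \<open>(-3,0)\<close> it covers the cell below that joint and its inner exit, while
  \<open>(3,0)\<close>, \<open>(-3,0)\<close> and the outer exits \<open>(4,0)\<close>,
  \<open>(-4,0)\<close> stay free.\<close>

definition seed_pos :: "pos list" where
  "seed_pos = [(3,-1), (2,-1), (2,0), (1,0), (1,-1), (1,-2), (0,-2), (-1,-2), (-2,-2), (-3,-2),
     (-3,-1), (-2,-1), (-2,0), (-1,0), (-1,-1), (0,-1)]"

text \<open>Coordinates relative to the joint of the launched tower. Besides the exits
  \<open>(1,0)\<close> and \<open>(-1,0)\<close> the path covers \<open>(3,0)\<close> and
  \<open>(-3,0)\<close>, where a joint under the second foot would go.\<close>

definition launch_pos :: "pos list" where
  "launch_pos = [(3,-2), (3,-1), (3,0), (2,0), (1,0), (1,-1), (1,-2), (0,-2), (-1,-2), (-2,-2),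
     (-3,-2), (-3,-1), (-3,0), (-2,0), (-1,0), (-1,-1), (0,-1)]"

text \<open>The ramp ends at height \<open>J * P - 3\<close>. The bounds put this height above the
  seed chain, whose rows are \<open>-2\<close> to \<open>0\<close>, and within the legs of tower 0,
  whose rows are \<open>1\<close> to \<open>M\<close>.\<close>

locale towers =
  fixes M P J :: nat
  assumes JP_ge: "5 \<le> J * P" and JP_le: "J * P \<le> M + 3"
begin

lemma J_pos: "0 < J" and P_pos: "0 < P" and M_gt_1: "1 < M"
proof -
  show "0 < J" "0 < P" using JP_ge by (auto intro: Nat.gr0I)
  show "1 < M" using JP_ge JP_le by linarith
qed

primrec len :: "fam \<Rightarrow> nat" where
  "len Seed_Chain = 16" | "len Launch = 17" | "len Joint = 1" | "len Spine = M" | "len Arch = 4"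
| "len Exit_W = 4" | "len Exit_E = 9" | "len Run = 8 * J - 1" | "len Ramp = P + 8"

text \<open>The tiles \<open>(f, j)\<close> with \<open>j < len f\<close> form a chain. The successor of \<open>(f, j)\<close> lies in direction
  \<open>dir_of f j\<close>; for the last tile this is the side that carries \<open>out_glue f\<close>.\<close>

primrec dir_of :: "fam \<Rightarrow> nat \<Rightarrow> dir" where
  "dir_of Seed_Chain j = seed_dirs ! j"
| "dir_of Launch j = launch_dirs ! j"
| "dir_of Joint j = North"
| "dir_of Spine j = North"
| "dir_of Arch j = (if j < 3 then West else South)"
| "dir_of Exit_W j = (if j < 3 then South else West)"
| "dir_of Exit_E j = (if j < 3 then South else West)"
| "dir_of Run j = (if Suc (Suc j) < 8 * J then West else North)"
| "dir_of Ramp j = (if Suc j < P then North else if j < P + 7 then East else North)"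

primrec in_dir :: "fam \<Rightarrow> dir" where
  "in_dir Seed_Chain = East" | "in_dir Launch = South" | "in_dir Joint = South"
| "in_dir Spine = South" | "in_dir Arch = South" | "in_dir Exit_W = East" | "in_dir Exit_E = West"
| "in_dir Run = East" | "in_dir Ramp = South"

primrec in_glue :: "fam \<Rightarrow> glue" where
  "in_glue Seed_Chain = Null" | "in_glue Launch = Upsilon" | "in_glue Joint = Eta"
| "in_glue Spine = Alpha" | "in_glue Arch = Beta" | "in_glue Exit_W = Kappa_W"
| "in_glue Exit_E = Kappa_E" | "in_glue Run = Omega" | "in_glue Ramp = Delta"

primrec out_glue :: "fam \<Rightarrow> glue" where
  "out_glue Seed_Chain = Eta" | "out_glue Launch = Eta" | "out_glue Joint = Alpha"
| "out_glue Spine = Beta" | "out_glue Arch = Beta" | "out_glue Exit_W = Omega"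
| "out_glue Exit_E = Omega" | "out_glue Run = Delta" | "out_glue Ramp = Delta"

definition back_dir :: "fam \<Rightarrow> nat \<Rightarrow> dir" where
  "back_dir f j = (case j of 0 \<Rightarrow> in_dir f | Suc i \<Rightarrow> opp (dir_of f i))"

text \<open>The extra glues of the only tiles at which growth can branch: the two exits of the
  joint, and the ramp tile that launches a tower while the ramp goes on.\<close>

definition side_glue :: "label \<Rightarrow> dir \<Rightarrow> glue" where
  "side_glue l d = (if l = (Joint, 0) \<and> d = West then Kappa_W
     else if l = (Joint, 0) \<and> d = East then Kappa_E
     else if l = (Ramp, P + 6) \<and> d = North then Upsilon else Null)"

definition glue_of :: "label \<Rightarrow> dir \<Rightarrow> glue" where
  "glue_of l d = (case l of (f, j) \<Rightarrow>
     if d = dir_of f j then (if Suc j = len f then out_glue f else Inner f j)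
     else if d = back_dir f j then (case j of 0 \<Rightarrow> in_glue f | Suc i \<Rightarrow> Inner f i)
     else side_glue l d)"

definition labels :: "label set" where
  "labels = {(f, j). j < len f}"

definition tile_of :: "label \<Rightarrow> tile" where
  "tile_of l = Tile (enc (glue_of l North)) (enc (glue_of l East)) (enc (glue_of l South))
     (enc (glue_of l West))"

section \<open>Which tile types bond, and on which sides\<close>

definition bond :: "label \<Rightarrow> dir \<Rightarrow> label \<Rightarrow> bool" where
  "bond l d m \<longleftrightarrow> glue_of l d = glue_of m (opp d) \<and> glue_of l d \<noteq> Null"

lemma interacts_tile_of_iff:
  "interacts p (tile_of l) q (tile_of m) \<longleftrightarrow> (\<exists>d. q = shift d p \<and> bond l d m)"
proof
  show "interacts p (tile_of l) q (tile_of m) \<Longrightarrow> \<exists>d. q = shift d p \<and> bond l d m"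
    unfolding interacts_def tile_of_def bond_def
    by (elim disjE; simp; metis opp.simps shift.simps fst_conv snd_conv)
  show "\<exists>d. q = shift d p \<and> bond l d m \<Longrightarrow> interacts p (tile_of l) q (tile_of m)"
    unfolding interacts_def tile_of_def bond_def
    by (elim exE, rename_tac d, case_tac d) auto
qed

lemma bond_sym: "bond l d m \<Longrightarrow> bond m (opp d) l"
  by (auto simp: bond_def)

text \<open>No chain turns straight back. Hence the two chain glues of a tile sit on different
  sides, and the first case of \<open>glue_of\<close> never hides the second.\<close>

lemma dir_of_neq_back_dir:
  assumes "j < len f"
  shows "dir_of f j \<noteq> back_dir f j"
proof -
  have "\<forall>j<16. seed_dirs ! j \<noteq> (case j of 0 \<Rightarrow> East | Suc i \<Rightarrow> opp (seed_dirs ! i))"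
    by (simp add: seed_dirs_def less_Suc_eq numeral_eq_Suc all_conj_distrib)
  from this[rule_format, of j]
  have seed: "j < 16 \<Longrightarrow> seed_dirs ! j \<noteq> (case j of 0 \<Rightarrow> East | Suc i \<Rightarrow> opp (seed_dirs ! i))" .
  have "\<forall>j<17. launch_dirs ! j \<noteq> (case j of 0 \<Rightarrow> South | Suc i \<Rightarrow> opp (launch_dirs ! i))"
    by (simp add: launch_dirs_def less_Suc_eq numeral_eq_Suc all_conj_distrib)
  from this[rule_format, of j]
  have "j < 17 \<Longrightarrow> launch_dirs ! j \<noteq> (case j of 0 \<Rightarrow> South | Suc i \<Rightarrow> opp (launch_dirs ! i))" .
  with seed show ?thesis
    using assms by (cases f; cases j) (auto simp: back_dir_def split: if_splits)
qed

lemma glue_of_eq_Inner_iff: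
  assumes "l \<in> labels"
  shows "glue_of l d = Inner f i \<longleftrightarrow>
    (l = (f, i) \<and> Suc i < len f \<and> d = dir_of f i) \<or> (l = (f, Suc i) \<and> d = opp (dir_of f i))"
proof -
  obtain g j where l: "l = (g, j)" "j < len g" using assms by (auto simp: labels_def)
  have [simp]: "in_glue g \<noteq> Inner f i" "out_glue g \<noteq> Inner f i" by (cases g; simp)+
  show ?thesis
    using dir_of_neq_back_dir[OF l(2)] l
    by (auto simp: glue_of_def side_glue_def back_dir_def split: nat.splits if_splits)
qed

lemma bond_Inner:
  assumes "bond l d m" "l \<in> labels" "m \<in> labels" "glue_of l d = Inner f i"
  shows "Suc i < len f" and
    "(l = (f, i) \<and> m = (f, Suc i) \<and> d = dir_of f i) \<or>
     (l = (f, Suc i) \<and> m = (f, i) \<and> d = opp (dir_of f i))"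
proof -
  have "glue_of m (opp d) = Inner f i" using assms by (simp add: bond_def)
  with assms show "(l = (f, i) \<and> m = (f, Suc i) \<and> d = dir_of f i) \<or>
     (l = (f, Suc i) \<and> m = (f, i) \<and> d = opp (dir_of f i))"
    by (auto simp: glue_of_eq_Inner_iff)
  with assms show "Suc i < len f" by (auto simp: labels_def)
qed

text \<open>The junctions between chains, oriented in the usual direction of growth.\<close>

definition linked :: "label \<Rightarrow> dir \<Rightarrow> label \<Rightarrow> bool" where
  "linked l d m \<longleftrightarrow>
     (l = (Seed_Chain, 15) \<and> d = North \<and> m = (Joint, 0)) \<or>
     (l = (Launch, 16) \<and> d = North \<and> m = (Joint, 0)) \<or>
     (l = (Joint, 0) \<and> d = North \<and> m = (Spine, 0)) \<or>
     (l = (Joint, 0) \<and> d = West \<and> m = (Exit_W, 0)) \<or>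
     (l = (Joint, 0) \<and> d = East \<and> m = (Exit_E, 0)) \<or>
     (l = (Spine, M - 1) \<and> d = North \<and> m = (Arch, 0)) \<or>
     (l = (Spine, M - 1) \<and> d = North \<and> m = (Arch, 3)) \<or>
     (l = (Exit_W, 3) \<and> d = West \<and> m = (Run, 0)) \<or>
     (l = (Exit_E, 8) \<and> d = West \<and> m = (Run, 0)) \<or>
     (l = (Run, 8 * J - 2) \<and> d = North \<and> m = (Ramp, 0)) \<or>
     (l = (Ramp, P + 7) \<and> d = North \<and> m = (Ramp, 0)) \<or>
     (l = (Ramp, P + 6) \<and> d = North \<and> m = (Launch, 0))"

text \<open>The complete table of the sides carrying each junction glue; matching opposite sides in
  it leaves just the pairs of \<open>linked\<close>.\<close>

definition glue_at :: "glue \<Rightarrow> label \<Rightarrow> dir \<Rightarrow> bool" where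
  "glue_at g l d \<longleftrightarrow> (case g of
      Null \<Rightarrow> True | Inner f i \<Rightarrow> True
    | Eta \<Rightarrow> (l = (Seed_Chain, 15) \<and> d = North) \<or> (l = (Launch, 16) \<and> d = North) \<or> (l = (Joint, 0) \<and> d = South)
    | Alpha \<Rightarrow> (l = (Joint, 0) \<and> d = North) \<or> (l = (Spine, 0) \<and> d = South)
    | Beta \<Rightarrow> (l = (Spine, M - 1) \<and> d = North) \<or> (l = (Arch, 0) \<and> d = South) \<or> (l = (Arch, 3) \<and> d = South)
    | Kappa_W \<Rightarrow> (l = (Joint, 0) \<and> d = West) \<or> (l = (Exit_W, 0) \<and> d = East)
    | Kappa_E \<Rightarrow> (l = (Joint, 0) \<and> d = East) \<or> (l = (Exit_E, 0) \<and> d = West)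
    | Omega \<Rightarrow> (l = (Exit_W, 3) \<and> d = West) \<or> (l = (Exit_E, 8) \<and> d = West) \<or> (l = (Run, 0) \<and> d = East)
    | Delta \<Rightarrow> (l = (Run, 8 * J - 2) \<and> d = North) \<or> (l = (Ramp, P + 7) \<and> d = North) \<or> (l = (Ramp, 0) \<and> d = South)
    | Upsilon \<Rightarrow> (l = (Ramp, P + 6) \<and> d = North) \<or> (l = (Launch, 0) \<and> d = South))"

lemma glue_at_glue_of:
  assumes "l \<in> labels"
  shows "glue_at (glue_of l d) l d"
proof -
  obtain f j where l: "l = (f, j)" "j < len f" using assms by (auto simp: labels_def)
  have *: "Suc 15 = 16" "seed_dirs ! 15 = North" "launch_dirs ! 16 = North"
    by (simp_all add: seed_dirs_def launch_dirs_def)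
  show ?thesis
    using l(2) J_pos M_gt_1 unfolding l(1)
    by (cases f; cases j)
       (auto simp: glue_of_def glue_at_def side_glue_def back_dir_def * split: if_splits)
qed

lemma linked_cases:
  assumes "bond l d m" "l \<in> labels" "m \<in> labels" "\<And>f i. glue_of l d \<noteq> Inner f i"
  shows "linked l d m \<or> linked m (opp d) l"
proof -
  have "glue_at (glue_of l d) l d" "glue_at (glue_of l d) m (opp d)" "glue_of l d \<noteq> Null"
    using assms glue_at_glue_of[of l d] glue_at_glue_of[of m "opp d"] by (auto simp: bond_def)
  then show ?thesis
    using assms(4) by (cases "glue_of l d"; cases d) (auto simp: glue_at_def linked_def)
qed

lemma linked_bond: "linked l d m \<Longrightarrow> bond l d m"
  using J_pos M_gt_1 P_pos
  by (auto simp: linked_def bond_def glue_of_def side_glue_def back_dir_def seed_dirs_def launch_dirs_def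
      split: nat.splits if_splits)

lemma Inner_bond: "Suc i < len f \<Longrightarrow> bond (f, i) (dir_of f i) (f, Suc i)"
  using glue_of_eq_Inner_iff[of "(f,i)" "dir_of f i" f i]
    glue_of_eq_Inner_iff[of "(f,Suc i)" "opp (dir_of f i)" f i]
  by (auto simp: bond_def labels_def)

text \<open>Makes the number of tile types equal to the number of labels. An inner glue reveals the
  chain, and within a chain the smaller index is betrayed by its outgoing inner glue, which no later
  tile carries on that side.\<close>

lemma inj_on_tile_of: "inj_on tile_of labels"
proof (rule inj_onI)
  fix l m
  assume l: "l \<in> labels" and m: "m \<in> labels" and "tile_of l = tile_of m"
  then have eq: "glue_of l d = glue_of m d" for d
    by (cases d) (auto simp: tile_of_def)
  obtain f j where lf: "l = (f, j)" "j < len f" using l by (auto simp: labels_def)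
  obtain g i where mg: "m = (g, i)" "i < len g" using m by (auto simp: labels_def)
  have below: "\<not> j < i" if "(f, j) \<in> labels" "(f, i) \<in> labels"
    "\<And>d. glue_of (f, j) d = glue_of (f, i) d" for f j i
  proof
    assume "j < i"
    then have "glue_of (f, j) (dir_of f j) = Inner f j"
      using that(2) by (subst glue_of_eq_Inner_iff[OF that(1)]) (auto simp: labels_def)
    then show False
      using that(3) \<open>j < i\<close> glue_of_eq_Inner_iff[OF that(2)] by auto
  qed
  have "f = g"
  \<comment> \<open>The joint is the only chain of length one, so it has no inner glue and is
    recognized by its exit glue.\<close>
  proof (cases "f = Joint")
    case True
    have "glue_of l West = Kappa_W"
      using True lf by (simp add: glue_of_def side_glue_def back_dir_def)
    then have "glue_at Kappa_W m West"
      using glue_at_glue_of[OF m, of West] eq by simp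
    then show ?thesis using True mg by (simp add: glue_at_def)
  next
    case False
    have "1 < len f" using False J_pos M_gt_1 by (cases f) auto
    then have "\<exists>d x. glue_of l d = Inner f x"
      using lf glue_of_eq_Inner_iff[OF l, of _ f] by (cases j) auto
    then show ?thesis using eq glue_of_eq_Inner_iff[OF m] mg by auto
  qed
  then show "l = m"
    using below[of f j i] below[of f i j] l m eq lf mg by (metis linorder_neqE_nat)
qed

lemma finite_labels: "finite labels"
  and card_labels: "card labels = 58 + M + 8 * J + P"
proof -
  have fams: "(UNIV :: fam set) =
      {Seed_Chain, Launch, Joint, Spine, Arch, Exit_W, Exit_E, Run, Ramp}"
    using fam.exhaust by blast
  have eq: "labels = Sigma UNIV (\<lambda>f. {..<len f})"
    by (auto simp: labels_def)
  show "finite labels" unfolding eq fams by auto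
  show "card labels = 58 + M + 8 * J + P"
    unfolding eq fams using J_pos by (subst card_SigmaI) auto
qed

end

section \<open>The placed tiles and their tree\<close>

text \<open>A node \<open>(I, k)\<close> is the \<open>k\<close>-th tile, in order of growth, of an occurrence \<open>I\<close> of a chain. Tower 0 is
  the first one, tower \<open>Suc i\<close> is launched by period \<open>i\<close> of the ramp; \<open>I_Up\<close> and \<open>I_Down\<close> are the two
  copies of the spine in a tower, and \<open>I_Turn\<close> is the joint under the second foot of tower 0.\<close>

datatype inst = I_Seed | I_Launch nat | I_Joint nat | I_Up nat | I_Arch nat | I_Down nat
  | I_Turn | I_Exit | I_Run | I_Ramp nat

type_synonym node = "inst \<times> nat"

text \<open>\<open>west t\<close> states that the arch of tower \<open>t\<close> extends to the west.\<close>

locale growth = towers +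
  fixes west :: "nat \<Rightarrow> bool"
begin

primrec fam_of :: "inst \<Rightarrow> fam" where
  "fam_of I_Seed = Seed_Chain" | "fam_of (I_Launch i) = Launch" | "fam_of (I_Joint t) = Joint"
| "fam_of (I_Up t) = Spine" | "fam_of (I_Arch t) = Arch" | "fam_of (I_Down t) = Spine"
| "fam_of I_Turn = Joint" | "fam_of I_Exit = (if west 0 then Exit_W else Exit_E)"
| "fam_of I_Run = Run" | "fam_of (I_Ramp i) = Ramp"

text \<open>Both end tiles of the arch have \<open>Beta\<close> on their south side: growth from
  \<open>(Arch, 0)\<close> goes west, growth from \<open>(Arch, 3)\<close> goes east through the
  chain backwards. The second foot is entered at the \<open>Beta\<close> end of the spine and thus
  always runs backwards.\<close>

primrec reversed :: "inst \<Rightarrow> bool" where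
  "reversed I_Seed = False" | "reversed (I_Launch i) = False" | "reversed (I_Joint t) = False"
| "reversed (I_Up t) = False" | "reversed (I_Arch t) = (\<not> west t)" | "reversed (I_Down t) = True"
| "reversed I_Turn = False" | "reversed I_Exit = False"
| "reversed I_Run = False" | "reversed (I_Ramp i) = False"

primrec present :: "inst \<Rightarrow> bool" where
  "present I_Seed = True" | "present (I_Launch i) = (i < J)" | "present (I_Joint t) = (t \<le> J)"
| "present (I_Up t) = (t \<le> J)" | "present (I_Arch t) = (t \<le> J)" | "present (I_Down t) = (t \<le> J)"
| "present I_Turn = True" | "present I_Exit = True"
| "present I_Run = True" | "present (I_Ramp i) = (i < J)"

text \<open>The last tile of the last ramp period is missing: its cell belongs to tower 0.\<close>

definition size_of :: "inst \<Rightarrow> nat" where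
  "size_of I = (if I = I_Ramp (J - 1) then P + 7 else len (fam_of I))"

definition nodes :: "node set" where
  "nodes = {(I, k). present I \<and> k < size_of I}"

definition label_of :: "node \<Rightarrow> label" where
  "label_of v = (case v of (I, k) \<Rightarrow>
     (fam_of I, if reversed I then len (fam_of I) - Suc k else k))"

text \<open>The column of the western leg of tower 0, which stops the ramp.\<close>

definition wall :: int where
  "wall = (if west 0 then -3 else 0)"

definition side :: "nat \<Rightarrow> int" where
  "side t = (if west t then -1 else 1)"

text \<open>Ramp period \<open>i\<close> rises in column \<open>wall + 8 * i - 8 * J\<close>, so
  that \<open>J\<close> periods lead exactly to \<open>wall\<close>. Its launching tile is seven
  columns further east, three columns east of the axis of tower \<open>Suc i\<close>.\<close>

definition base_x :: "nat \<Rightarrow> int" where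
  "base_x t = (if t = 0 then 0 else wall + 8 * int t - 8 * int J - 4)"

definition base_y :: "nat \<Rightarrow> int" where
  "base_y t = int t * int P"

primrec place :: "inst \<Rightarrow> nat \<Rightarrow> pos" where
  "place I_Seed k = seed_pos ! k"
| "place (I_Launch i) k =
     (base_x (Suc i) + fst (launch_pos ! k), base_y (Suc i) + snd (launch_pos ! k))"
| "place (I_Joint t) k = (base_x t, base_y t)"
| "place (I_Up t) k = (base_x t, base_y t + 1 + int k)"
| "place (I_Arch t) k = (base_x t + side t * int k, base_y t + 1 + int M)"
| "place (I_Down t) k = (base_x t + 3 * side t, base_y t + int M - int k)"
| "place I_Turn k = (3 * side 0, 0)"
| "place I_Exit k = (if west 0 then (-4, - int k)
     else if k < 4 then (4, - int k) else (7 - int k, -3))"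
| "place I_Run k = (wall - 2 - int k, -3)"
| "place (I_Ramp i) k =
     (if k < P then (wall + 8 * int i - 8 * int J, base_y i - 2 + int k)
      else (wall + 8 * int i - 8 * int J + int k - int P + 1, base_y (Suc i) - 3))"

definition pos_of :: "node \<Rightarrow> pos" where
  "pos_of v = place (fst v) (snd v)"

primrec origin :: "inst \<Rightarrow> node" where
  "origin I_Seed = (I_Seed, 0)"
| "origin (I_Launch i) = (I_Ramp i, P + 6)"
| "origin (I_Joint t) = (case t of 0 \<Rightarrow> (I_Seed, 15) | Suc i \<Rightarrow> (I_Launch i, 16))"
| "origin (I_Up t) = (I_Joint t, 0)"
| "origin (I_Arch t) = (I_Up t, M - 1)"
| "origin (I_Down t) = (I_Arch t, 3)"
| "origin I_Turn = (I_Down 0, M - 1)"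
| "origin I_Exit = (I_Turn, 0)"
| "origin I_Run = (I_Exit, if west 0 then 3 else 8)"
| "origin (I_Ramp i) = (case i of 0 \<Rightarrow> (I_Run, 8 * J - 2) | Suc j \<Rightarrow> (I_Ramp j, P + 7))"

definition parent :: "node \<Rightarrow> node" where
  "parent v = (case snd v of 0 \<Rightarrow> origin (fst v) | Suc k \<Rightarrow> (fst v, k))"

definition root :: node where
  "root = (I_Seed, 0)"

definition step_dir :: "inst \<Rightarrow> nat \<Rightarrow> dir" where
  "step_dir I k = (if reversed I then opp (dir_of (fam_of I) (len (fam_of I) - Suc (Suc k)))
     else dir_of (fam_of I) k)"

section \<open>Every node is adjacent and bonded to its parent\<close>

lemma place_Suc:
  assumes "Suc k < len (fam_of I)"
  shows "place I (Suc k) = shift (step_dir I k) (place I k)"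
proof -
  have s: "\<forall>k<15. seed_pos ! Suc k = shift (seed_dirs ! k) (seed_pos ! k)"
    by (simp add: seed_dirs_def seed_pos_def less_Suc_eq numeral_eq_Suc all_conj_distrib)
  have l: "\<forall>k<16. launch_pos ! Suc k = shift (launch_dirs ! k) (launch_pos ! k)"
    by (simp add: launch_dirs_def launch_pos_def less_Suc_eq numeral_eq_Suc all_conj_distrib)
  show ?thesis
  proof (cases I)
    case I_Seed
    with assms s show ?thesis by (simp add: step_dir_def)
  next
    case (I_Launch i)
    have "launch_pos ! Suc k = shift (launch_dirs ! k) (launch_pos ! k)"
      using assms l I_Launch by simp
    with I_Launch show ?thesis by (cases "launch_dirs ! k") (auto simp: step_dir_def)
  next
    case (I_Arch t)
    with assms show ?thesis by (auto simp: step_dir_def side_def)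
  next
    case (I_Ramp i)
    then show ?thesis using assms by (auto simp: step_dir_def base_y_def algebra_simps)
  qed (use assms in \<open>auto simp: step_dir_def\<close>)
qed

lemma size_of_le: "size_of I \<le> len (fam_of I)"
  by (auto simp: size_of_def)

lemma label_of_in_labels: "v \<in> nodes \<Longrightarrow> label_of v \<in> labels"
  using size_of_le[of "fst v"] by (auto simp: nodes_def label_of_def labels_def)

lemma label_of_Suc:
  assumes "Suc k < len (fam_of I)"
  shows "bond (label_of (I, k)) (step_dir I k) (label_of (I, Suc k))"
proof (cases "reversed I")
  case True
  define i where "i = len (fam_of I) - Suc (Suc k)"
  have "Suc i < len (fam_of I)" "len (fam_of I) - Suc k = Suc i"
    using assms by (auto simp: i_def)
  with True bond_sym[OF Inner_bond] show ?thesis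
    by (simp add: label_of_def step_dir_def flip: i_def)
next
  case False
  with assms Inner_bond show ?thesis by (simp add: label_of_def step_dir_def)
qed

lemma origin_linked:
  assumes "present I" "I \<noteq> I_Seed"
  shows "\<exists>d. pos_of (I, 0) = shift d (pos_of (origin I)) \<and> bond (label_of (origin I)) d (label_of (I, 0))"
proof -
  \<comment> \<open>The second disjunct serves \<open>I_Down\<close> and \<open>I_Turn\<close>,
    which are entered against the orientation of \<open>linked\<close>.\<close>
  have "\<exists>d. pos_of (I, 0) = shift d (pos_of (origin I)) \<and>
    (linked (label_of (origin I)) d (label_of (I, 0)) \<or>
     linked (label_of (I, 0)) (opp d) (label_of (origin I)))"
  proof (cases I)
    case (I_Launch i)
    then show ?thesis
      by (intro exI[of _ North]) (auto simp: pos_of_def label_of_def linked_def launch_pos_def base_x_def)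
  next
    case (I_Joint t)
    then show ?thesis
      by (intro exI[of _ North]; cases t) (auto simp: pos_of_def label_of_def linked_def launch_pos_def seed_pos_def base_x_def base_y_def)
  next
    case (I_Up t)
    then show ?thesis
      by (intro exI[of _ North]) (auto simp: pos_of_def label_of_def linked_def)
  next
    case (I_Arch t)
    then show ?thesis using M_gt_1
      by (intro exI[of _ North]) (auto simp: pos_of_def label_of_def linked_def)
  next
    case (I_Down t)
    then show ?thesis using M_gt_1
      by (intro exI[of _ South]) (auto simp: pos_of_def label_of_def linked_def)
  next
    case I_Turn
    then show ?thesis using M_gt_1
      by (intro exI[of _ South]) (auto simp: pos_of_def label_of_def linked_def base_x_def base_y_def)
  next
    case I_Exit
    then show ?thesis
      by (intro exI[of _ "if west 0 then West else East"]) (auto simp: pos_of_def label_of_def linked_def side_def)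
  next
    case I_Run
    then show ?thesis
      by (intro exI[of _ West]) (auto simp: pos_of_def label_of_def linked_def wall_def)
  next
    case (I_Ramp i)
    then show ?thesis using P_pos J_pos
      by (intro exI[of _ North]; cases i) (auto simp: pos_of_def label_of_def linked_def base_y_def)
  qed (use assms in auto)
  then show ?thesis using linked_bond bond_sym by (metis opp_opp)
qed

lemma parent_bond:
  assumes "v \<in> nodes" "v \<noteq> root"
  shows "\<exists>d. pos_of v = shift d (pos_of (parent v)) \<and> bond (label_of (parent v)) d (label_of v)"
proof -
  obtain I k where v: "v = (I, k)" by force
  show ?thesis
  proof (cases k)
    case 0
    with v assms origin_linked[of I] show ?thesis
      by (auto simp: parent_def nodes_def root_def)
  next
    case (Suc j)
    have "Suc j < len (fam_of I)"
      using assms v Suc size_of_le[of I] by (auto simp: nodes_def)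
    then show ?thesis
      using v Suc place_Suc[of j I] label_of_Suc[of j I] by (auto simp: parent_def pos_of_def)
  qed
qed

section \<open>Parent-closed sets of nodes and the blocking tiles they contain\<close>

definition closed :: "node set \<Rightarrow> bool" where
  "closed A \<longleftrightarrow> A \<subseteq> nodes \<and> (\<forall>v\<in>A. v \<noteq> root \<longrightarrow> parent v \<in> A)"

lemma closed_le:
  assumes "closed A" "(I, k) \<in> A" "j \<le> k"
  shows "(I, j) \<in> A"
  using assms(3,2)
proof (induction rule: inc_induct)
  case (step n)
  then show ?case using assms(1) by (auto simp: closed_def parent_def root_def dest!: bspec)
qed

lemma closed_origin:
  assumes "closed A" "(I, k) \<in> A" "I \<noteq> I_Seed"
  shows "origin I \<in> A"
proof -
  have "(I, 0) \<in> A" using closed_le[OF assms(1,2)] by simp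
  then show ?thesis using assms(1,3) by (auto simp: closed_def parent_def root_def dest!: bspec)
qed

text \<open>The tiles around a joint precede it in the tree; this and the next lemmas supply the
  blockers for unwanted attachments.\<close>

lemma closed_joint:
  assumes "closed A" "(I_Joint t, k) \<in> A"
  shows "t = 0 \<Longrightarrow> j < 16 \<Longrightarrow> (I_Seed, j) \<in> A"
    and "t = Suc i \<Longrightarrow> j < 17 \<Longrightarrow> (I_Launch i, j) \<in> A"
  using closed_origin[OF assms] closed_le[OF assms(1), of I_Seed 15 j]
    closed_le[OF assms(1), of "I_Launch i" 16 j] by auto

lemma closed_down:
  assumes "closed A" "(I_Down t, k) \<in> A"
  shows "(I_Joint t, 0) \<in> A" and "j < M \<Longrightarrow> (I_Up t, j) \<in> A"
proof -
  have "(I_Arch t, 3) \<in> A" using closed_origin[OF assms] by simp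
  then have up: "(I_Up t, M - 1) \<in> A" using closed_origin[OF assms(1)] by fastforce
  then show "(I_Joint t, 0) \<in> A" using closed_origin[OF assms(1)] by fastforce
  show "j < M \<Longrightarrow> (I_Up t, j) \<in> A" using closed_le[OF assms(1) up] by simp
qed

lemma closed_turn:
  assumes "closed A" "(I_Turn, k) \<in> A"
  shows "j < M \<Longrightarrow> (I_Down 0, j) \<in> A" and "j < M \<Longrightarrow> (I_Up 0, j) \<in> A"
    and "j < 16 \<Longrightarrow> (I_Seed, j) \<in> A"
proof -
  have down: "(I_Down 0, M - 1) \<in> A" using closed_origin[OF assms] by simp
  then show "j < M \<Longrightarrow> (I_Down 0, j) \<in> A" using closed_le[OF assms(1)] by fastforce
  show "j < M \<Longrightarrow> (I_Up 0, j) \<in> A" using closed_down[OF assms(1) down] by simp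
  show "j < 16 \<Longrightarrow> (I_Seed, j) \<in> A"
    using closed_joint(1)[OF assms(1) closed_down(1)[OF assms(1) down]] by simp
qed

text \<open>The way back from a ramp tile passes through the run, the exit and the turn. So by
  \<open>closed_turn\<close> both legs of tower 0 are complete before the ramp starts.\<close>

lemma closed_ramp:
  assumes "closed A"
  shows "(I_Ramp i, k) \<in> A \<Longrightarrow> (I_Turn, 0) \<in> A"
proof (induction i arbitrary: k)
  case 0
  then have "(I_Run, 8 * J - 2) \<in> A" using closed_origin[OF assms] by fastforce
  then have "(I_Exit, if west 0 then 3 else 8) \<in> A" using closed_origin[OF assms] by fastforce
  then show ?case using closed_origin[OF assms] by fastforce
next
  case (Suc i)
  then show ?case using closed_origin[OF assms] by fastforce
qed

section \<open>A free cell can only be filled by a child in the tree\<close>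

lemma bond_Inner_step:
  assumes "bond (label_of (I, k)) d l" "(I, k) \<in> nodes" "l \<in> labels"
    and "glue_of (label_of (I, k)) d = Inner f i"
  shows "(Suc k < len (fam_of I) \<and> d = step_dir I k \<and> l = label_of (I, Suc k)) \<or>
    (\<exists>j. k = Suc j \<and> d = opp (step_dir I j))"
proof -
  have k: "k < len (fam_of I)" using assms(2) size_of_le[of I] by (auto simp: nodes_def)
  note b = bond_Inner[OF assms(1) label_of_in_labels[OF assms(2)] assms(3,4)]
  show ?thesis
  proof (cases "reversed I")
    case False
    with b show ?thesis by (cases k) (auto simp: label_of_def step_dir_def)
  next
    case True
    from b(2) show ?thesis
    proof (elim disjE conjE)
      assume *: "label_of (I, k) = (f, i)" "l = (f, Suc i)" "d = dir_of f i"
      then have f: "f = fam_of I" "len (fam_of I) - Suc k = i"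
        using True by (auto simp: label_of_def)
      with b(1) have "k \<noteq> 0" by auto
      then obtain j where "k = Suc j" by (cases k) auto
      then show ?thesis using * f True by (simp add: step_dir_def)
    next
      assume *: "label_of (I, k) = (f, Suc i)" "l = (f, i)" "d = opp (dir_of f i)"
      then have f: "f = fam_of I" "len (fam_of I) - Suc k = Suc i"
        using True by (auto simp: label_of_def)
      then have "len (fam_of I) - Suc (Suc k) = i" "Suc k < len (fam_of I)" by auto
      then show ?thesis using * f True by (simp add: step_dir_def label_of_def)
    qed
  qed
qed

text \<open>The cell above the first spine of a tower, where the two ends of the arch
  compete.\<close>

definition top :: "nat \<Rightarrow> pos" where
  "top t = (base_x t, base_y t + 1 + int M)"

text \<open>The cell in question is that of the omitted tile \<open>P + 7\<close> of the last ramp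
  period. It lies in the western leg of tower 0, which is the second foot if the arch goes west and
  the first spine otherwise.\<close>

lemma wall_blocks_ramp:
  assumes "closed A" "(I_Ramp (J - 1), k) \<in> A"
  shows "(wall, int J * int P - 3) \<in> pos_of ` A"
proof -
  note turn = closed_turn[OF assms(1) closed_ramp[OF assms]]
  have JP: "int J * int P = int (J * P)" by simp
  show ?thesis
  proof (cases "west 0")
    case True
    \<comment> \<open>Tile \<open>k\<close> of the second foot has height \<open>M - k\<close>, to
      be equated with \<open>J * P - 3\<close>.\<close>
    have "(I_Down 0, M + 3 - J * P) \<in> A" using turn(1) JP_ge JP_le by simp
    moreover have "pos_of (I_Down 0, M + 3 - J * P) = (wall, int J * int P - 3)"
      using True JP_le unfolding JP by (simp add: pos_of_def wall_def side_def base_x_def base_y_def of_nat_diff)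
    ultimately show ?thesis by (metis image_eqI)
  next
    case False
    \<comment> \<open>Tile \<open>k\<close> of the first spine has height
      \<open>k + 1\<close>.\<close>
    have "(I_Up 0, J * P - 4) \<in> A" using turn(2) JP_ge JP_le by simp
    moreover have "pos_of (I_Up 0, J * P - 4) = (wall, int J * int P - 3)"
      using False JP_ge unfolding JP by (simp add: pos_of_def wall_def side_def base_x_def base_y_def of_nat_diff)
    ultimately show ?thesis by (metis image_eqI)
  qed
qed

text \<open>The heart of determinism. A glue of a placed tile leads to a child, back to its parent,
  or into a cell that an earlier tile of the closed set occupies. The sole true choice is the end of
  the arch placed on a spine, and \<open>choice\<close> settles it in favour of
  \<open>west\<close>.\<close>

lemma new_tile_is_child:
  assumes A: "closed A" and v: "v \<in> A" and l: "l \<in> labels" and bond: "bond (label_of v) d l"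
    and free: "shift d (pos_of v) \<notin> pos_of ` A"
    and choice: "\<And>t. t \<le> J \<Longrightarrow> shift d (pos_of v) = top t \<Longrightarrow> l \<in> {(Arch, 0), (Arch, 3)} \<Longrightarrow>
      l = label_of (I_Arch t, 0)"
  shows "\<exists>u\<in>nodes. u \<noteq> root \<and> parent u = v \<and> pos_of u = shift d (pos_of v) \<and> label_of u = l"
proof -
  obtain I k where vI: "v = (I, k)" by force
  have vn: "(I, k) \<in> nodes" using A v vI by (auto simp: closed_def)
  then have k: "present I" "k < size_of I" "k < len (fam_of I)"
    using size_of_le[of I] by (auto simp: nodes_def)
  have occupied: False if "u \<in> A" "pos_of u = shift d (pos_of v)" for u
    using free that by (metis image_eqI)
  show ?thesis
  proof (cases "\<exists>f i. glue_of (label_of v) d = Inner f i")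
    case True
    then consider "Suc k < len (fam_of I)" "d = step_dir I k" "l = label_of (I, Suc k)"
      | j where "k = Suc j" "d = opp (step_dir I j)"
      using bond_Inner_step[of I k d l] bond vn l vI by blast
    then show ?thesis
    proof cases
      case 1
      have next_pos: "pos_of (I, Suc k) = shift d (pos_of v)"
        using place_Suc[OF 1(1)] 1(2) vI by (simp add: pos_of_def)
      show ?thesis
      proof (cases "Suc k < size_of I")
        case True
        then show ?thesis using 1 k next_pos vI
          by (intro bexI[of _ "(I, Suc k)"]) (auto simp: nodes_def root_def parent_def)
      next
        case False
        \<comment> \<open>Only the last ramp period is cut short, and its next cell belongs to the
          wall.\<close>
        then have I: "I = I_Ramp (J - 1)" "k = P + 6"
          using 1(1) k by (auto simp: size_of_def split: if_splits)
        then have "pos_of (I, Suc k) = (wall, int J * int P - 3)"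
          using J_pos by (simp add: pos_of_def base_y_def of_nat_diff)
        then show ?thesis using wall_blocks_ramp[OF A] v vI I free next_pos by metis
      qed
    next
      case 2
      have "(I, j) \<in> A" using closed_le[OF A] v vI 2(1) by simp
      moreover have "pos_of (I, j) = shift d (pos_of v)"
        using place_Suc[of j I] 2 k vI by (simp add: pos_of_def)
      ultimately show ?thesis using occupied by blast
    qed
  next
    case False
    then have link: "linked (label_of v) d l \<or> linked l (opp d) (label_of v)"
      using linked_cases[OF bond label_of_in_labels l] vn vI by auto
    have child: ?thesis
      if "present K" "K \<noteq> I_Seed" "origin K = v" "pos_of (K, 0) = shift d (pos_of v)"
        "label_of (K, 0) = l" for K
    proof -
      have "0 < size_of K" using J_pos M_gt_1 by (cases K) (auto simp: size_of_def)
      with that show ?thesis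
        by (intro bexI[of _ "(K, 0)"]) (auto simp: nodes_def root_def parent_def)
    qed
    show ?thesis
    \<comment> \<open>A junction glue on the entry side points back at the origin, whose cell is
      occupied; \<open>not_parent\<close> discards this side in all cases below.\<close>
    proof (cases "k = 0 \<and> I \<noteq> I_Seed \<and> pos_of (origin I) = shift d (pos_of v)")
      case True
      then show ?thesis using closed_origin[OF A] v vI occupied by blast
    next
      case not_parent: False
      note defs = pos_of_def label_of_def linked_def base_x_def base_y_def
      show ?thesis
      proof (cases I)
        case I_Seed
        then have "k = 15" "d = North" "l = (Joint, 0)"
          using link vI by (auto simp: label_of_def linked_def)
        then show ?thesis
          using I_Seed vI by (intro child[of "I_Joint 0"]) (auto simp: defs seed_pos_def)
      next
        case (I_Launch i)
        then have "k = 16 \<and> d = North \<and> l = (Joint, 0)"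
          using link vI not_parent by (cases d) (auto simp: defs launch_pos_def)
        then show ?thesis
          using I_Launch vI k
          by (intro child[of "I_Joint (Suc i)"]) (auto simp: defs launch_pos_def)
      next
        case (I_Joint t)
        then have k0: "k = 0" using k by (simp add: size_of_def)
        then have "d \<noteq> South"
          using not_parent I_Joint vI
          by (cases t) (auto simp: defs launch_pos_def seed_pos_def)
        then consider "d = North" "l = (Spine, 0)" | "d = West" | "d = East"
          using link vI k0 I_Joint by (cases d) (auto simp: label_of_def linked_def)
        then show ?thesis
        proof cases
          case 1
          then show ?thesis
            using I_Joint vI k k0 by (intro child[of "I_Up t"]) (auto simp: defs)
        next
          case 2
          \<comment> \<open>The exits of a joint are filled by tiles 13 (west) and 3 (east) of the
            seed chain, or by tiles 14 and 4 of a launch chain.\<close>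
          have False if "t = 0" using that occupied[of "(I_Seed, 13)"] closed_joint(1)[OF A, of t k 13] v vI I_Joint 2
            by (auto simp: defs seed_pos_def)
          moreover have False if "t = Suc i" for i
            using that occupied[of "(I_Launch i, 14)"] closed_joint(2)[OF A, of t k i 14] v vI I_Joint 2
            by (auto simp: defs launch_pos_def)
          ultimately show ?thesis by (cases t) auto
        next
          case 3
          have False if "t = 0" using that occupied[of "(I_Seed, 3)"] closed_joint(1)[OF A, of t k 3] v vI I_Joint 3
            by (auto simp: defs seed_pos_def)
          moreover have False if "t = Suc i" for i
            using that occupied[of "(I_Launch i, 4)"] closed_joint(2)[OF A, of t k i 4] v vI I_Joint 3
            by (auto simp: defs launch_pos_def)
          ultimately show ?thesis by (cases t) auto
        qed
      next
        case (I_Up t)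
        then have *: "k = M - 1" "d = North" "l \<in> {(Arch, 0), (Arch, 3)}"
          using link vI not_parent by (cases d; auto simp: defs)+
        then have "pos_of (I_Arch t, 0) = shift d (pos_of v)"
          using I_Up vI M_gt_1 by (auto simp: defs)
        moreover from this have "l = label_of (I_Arch t, 0)"
          using choice[of t] * I_Up k by (simp add: pos_of_def top_def)
        ultimately show ?thesis
          using I_Up vI k * by (intro child[of "I_Arch t"]) auto
      next
        case (I_Arch t)
        then have "k < 4" using k by simp
        with I_Arch have "k = 3" "d = South" "l = (Spine, M - 1)"
          using link vI not_parent M_gt_1 by (cases d; auto simp: defs split: if_splits)+
        then show ?thesis
          using I_Arch vI k by (intro child[of "I_Down t"]) (auto simp: defs)
      next
        case (I_Down t)
        then have *: "k = M - 1" "d = South" "l = (Joint, 0)"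
          using link vI not_parent k by (cases d; auto simp: defs)+
        show ?thesis
        proof (cases t)
          case 0
          then show ?thesis
            using I_Down vI k * by (intro child[of I_Turn]) (auto simp: defs)
        next
          case (Suc i)
          have "(I_Launch i, j) \<in> A" if "j < 17" for j
            using closed_down(1)[OF A] closed_joint(2)[OF A _ Suc that] v vI I_Down by blast
          \<comment> \<open>Tiles 2 and 12 of the launch chain occupy the cells below an eastern and
            a western second foot, so no second joint forms there.\<close>
          then have "(I_Launch i, 2) \<in> A" "(I_Launch i, 12) \<in> A" by auto
          then show ?thesis
            using occupied[of "(I_Launch i, if west t then 12 else 2)"] I_Down vI Suc * M_gt_1
            by (auto simp: defs launch_pos_def side_def split: if_splits)
        qed
      next
        case I_Turn
        have seed: "j < 16 \<Longrightarrow> (I_Seed, j) \<in> A" for j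
          using closed_turn(3)[OF A] v vI I_Turn by blast
        have k0: "k = 0" using k I_Turn by (simp add: size_of_def)
        \<comment> \<open>North is the parent. Seed tile 10 or 0 lies below the turn and seed tile
          12 or 2 at its inner exit, for a western or eastern arch respectively; only the outer exit
          is open.\<close>
        have "d \<noteq> North"
          using not_parent I_Turn vI k0 M_gt_1 by (auto simp: defs)
        moreover have "d \<noteq> South"
          using occupied[of "(I_Seed, if west 0 then 10 else 0)"] seed I_Turn vI
          by (cases "west 0") (auto simp: defs seed_pos_def side_def)
        moreover have "d = West \<Longrightarrow> west 0"
          using occupied[of "(I_Seed, 2)"] seed I_Turn vI
          by (cases "west 0") (auto simp: defs seed_pos_def side_def)
        moreover have "d = East \<Longrightarrow> \<not> west 0"
          using occupied[of "(I_Seed, 12)"] seed I_Turn vI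
          by (cases "west 0") (auto simp: defs seed_pos_def side_def)
        ultimately have "d = (if west 0 then West else East)"
          "l = (if west 0 then Exit_W else Exit_E, 0)"
          using link vI k0 I_Turn by (cases d; auto simp: label_of_def linked_def)+
        then show ?thesis
          using I_Turn vI k0 by (intro child[of I_Exit]) (auto simp: defs side_def)
      next
        case I_Exit
        then have "k = (if west 0 then 3 else 8)" "d = West" "l = (Run, 0)"
          using link vI not_parent by (cases d; auto simp: defs side_def split: if_splits)+
        then show ?thesis
          using I_Exit vI k by (intro child[of I_Run]) (auto simp: defs wall_def)
      next
        case I_Run
        then have "k = 8 * J - 2" "d = North" "l = (Ramp, 0)"
          using link vI not_parent by (cases d; auto simp: defs wall_def split: if_splits)+
        then show ?thesis
          using I_Run vI k J_pos P_pos by (intro child[of "I_Ramp 0"]) (auto simp: defs)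
      next
        case (I_Ramp i)
        have "\<not> (k = 0 \<and> d = South)"
          using not_parent I_Ramp vI P_pos J_pos by (cases i) (auto simp: defs)
        then consider "k = P + 7" "d = North" "l = (Ramp, 0)"
          | "k = P + 6" "d = North" "l = (Launch, 0)"
          using link vI I_Ramp by (cases d) (auto simp: label_of_def linked_def)
        then show ?thesis
        proof cases
          case 1
          \<comment> \<open>Tile \<open>P + 7\<close> exists only in periods before the last one, so
            there is a next period to start.\<close>
          then have "Suc i < J" using I_Ramp k by (auto simp: size_of_def split: if_splits)
          then show ?thesis
            using I_Ramp vI k 1 P_pos by (intro child[of "I_Ramp (Suc i)"]) (auto simp: defs)
        next
          case 2
          then show ?thesis
            using I_Ramp vI k by (intro child[of "I_Launch i"]) (auto simp: defs launch_pos_def)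
        qed
      qed
    qed
  qed
qed

text \<open>The chains are reached one after the other in the order of growth. The facts about a
  tower are conditional on its entry, because tower 0 comes before the ramp and all other towers
  come after it.\<close>

lemma nodes_induct:
  assumes "root \<in> A" and child: "\<And>v. v \<in> nodes \<Longrightarrow> v \<noteq> root \<Longrightarrow> parent v \<in> A \<Longrightarrow> v \<in> A"
  shows "nodes \<subseteq> A"
proof -
  have run: "(I, k) \<in> A" if "present I" "I = I_Seed \<or> origin I \<in> A" "k < size_of I" for I k
    using that(3)
  proof (induction k)
    case 0
    then show ?case
      using that assms(1) child[of "(I, 0)"] by (auto simp: nodes_def root_def parent_def)
  next
    case (Suc k)
    then show ?case
      using that child[of "(I, Suc k)"] by (auto simp: nodes_def root_def parent_def)
  qed
  have sizes: "size_of I = len (fam_of I)" if "\<And>i. I \<noteq> I_Ramp i" for I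
    using that by (auto simp: size_of_def)
  have tower: "(I_Joint t, k) \<in> A \<and> (I_Up t, k) \<in> A"
    if "t \<le> J" "origin (I_Joint t) \<in> A" "k = 0" for t k
    using run[of "I_Joint t"] run[of "I_Up t"] that M_gt_1 by (simp add: sizes)
  have up: "k < M \<Longrightarrow> (I_Up t, k) \<in> A" if "t \<le> J" "origin (I_Joint t) \<in> A" for t k
    using run[of "I_Up t"] that tower[of t] by (simp add: sizes)
  have arch: "k < 4 \<Longrightarrow> (I_Arch t, k) \<in> A" if "t \<le> J" "origin (I_Joint t) \<in> A" for t k
    using run[of "I_Arch t"] that up[of t] M_gt_1 by (simp add: sizes)
  have down: "k < M \<Longrightarrow> (I_Down t, k) \<in> A" if "t \<le> J" "origin (I_Joint t) \<in> A" for t k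
    using run[of "I_Down t"] that arch[of t] by (simp add: sizes)
  have seed: "k < 16 \<Longrightarrow> (I_Seed, k) \<in> A" for k
    using run[of I_Seed] by (simp add: sizes)
  have turn: "(I_Turn, 0) \<in> A"
    using run[of I_Turn] down[of 0 "M - 1"] seed M_gt_1 by (simp add: sizes)
  have exit: "k < len (fam_of I_Exit) \<Longrightarrow> (I_Exit, k) \<in> A" for k
    using run[of I_Exit] turn by (simp add: sizes)
  have run_chain: "k < 8 * J - 1 \<Longrightarrow> (I_Run, k) \<in> A" for k
    using run[of I_Run] exit by (simp add: sizes)
  have ramp: "i < J \<Longrightarrow> k < size_of (I_Ramp i) \<Longrightarrow> (I_Ramp i, k) \<in> A" for i k
  proof (induction i arbitrary: k)
    case 0
    then show ?case using run[of "I_Ramp 0"] run_chain J_pos by simp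
  next
    case (Suc i)
    then show ?case using run[of "I_Ramp (Suc i)"] by (simp add: size_of_def)
  qed
  have launch: "i < J \<Longrightarrow> k < 17 \<Longrightarrow> (I_Launch i, k) \<in> A" for i k
    using run[of "I_Launch i"] ramp[of i] by (auto simp: size_of_def)
  have entry: "origin (I_Joint t) \<in> A" if "t \<le> J" for t
    using that seed launch by (cases t) auto
  show ?thesis
  proof (rule subsetI, clarify)
    fix I k assume "(I, k) \<in> nodes"
    then have k: "present I" "k < size_of I" "k < len (fam_of I)"
      using size_of_le[of I] by (auto simp: nodes_def)
    then show "(I, k) \<in> A"
      using tower up arch down seed turn exit run_chain ramp launch entry by (cases I) auto
  qed
qed

section \<open>Distinct nodes occupy distinct cells\<close>

lemma base_y_simps: "base_y 0 = 0" "base_y (Suc i) = base_y i + int P" "0 \<le> base_y t"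
  "5 \<le> base_y J"
  using JP_ge by (auto simp: base_y_def algebra_simps simp flip: of_nat_mult)

lemma base_y_mono: "s \<le> t \<Longrightarrow> base_y s \<le> base_y t"
  by (simp add: base_y_def mult_right_mono)

text \<open>The tower in whose strip of seven columns an occurrence lies; exit, run and ramp are
  kept apart by bounds of their own.\<close>

primrec home :: "inst \<Rightarrow> nat option" where
  "home I_Seed = Some 0" | "home (I_Launch i) = Some (Suc i)" | "home (I_Joint t) = Some t"
| "home (I_Up t) = Some t" | "home (I_Arch t) = Some t" | "home (I_Down t) = Some t"
| "home I_Turn = Some 0" | "home I_Exit = None" | "home I_Run = None" | "home (I_Ramp i) = None"

lemma seed_pos_bounds:
  assumes "k < 16"
  shows "fst (seed_pos ! k) \<in> {-3..3}" "snd (seed_pos ! k) \<in> {-2..0}"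
    "seed_pos ! k \<noteq> (0, 0)" "seed_pos ! k \<noteq> (3, 0)" "seed_pos ! k \<noteq> (-3, 0)"
proof -
  have "\<forall>k<16. fst (seed_pos ! k) \<in> {-3..3} \<and> snd (seed_pos ! k) \<in> {-2..0} \<and>
    seed_pos ! k \<noteq> (0, 0) \<and> seed_pos ! k \<noteq> (3, 0) \<and> seed_pos ! k \<noteq> (-3, 0)"
    by (simp add: seed_pos_def less_Suc_eq numeral_eq_Suc all_conj_distrib)
  then show "fst (seed_pos ! k) \<in> {-3..3}" "snd (seed_pos ! k) \<in> {-2..0}"
    "seed_pos ! k \<noteq> (0, 0)" "seed_pos ! k \<noteq> (3, 0)" "seed_pos ! k \<noteq> (-3, 0)"
    using assms by blast+
qed

lemma launch_pos_bounds:
  assumes "k < 17"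
  shows "fst (launch_pos ! k) \<in> {-3..3}" "snd (launch_pos ! k) \<in> {-2..0}" "launch_pos ! k \<noteq> (0, 0)"
proof -
  have "\<forall>k<17. fst (launch_pos ! k) \<in> {-3..3} \<and> snd (launch_pos ! k) \<in> {-2..0} \<and>
    launch_pos ! k \<noteq> (0, 0)"
    by (simp add: launch_pos_def less_Suc_eq numeral_eq_Suc all_conj_distrib)
  then show "fst (launch_pos ! k) \<in> {-3..3}" "snd (launch_pos ! k) \<in> {-2..0}" "launch_pos ! k \<noteq> (0, 0)"
    using assms by blast+
qed

lemma chain_pos_inj:
  "k < 16 \<Longrightarrow> j < 16 \<Longrightarrow> seed_pos ! k = seed_pos ! j \<Longrightarrow> k = j"
  "k < 17 \<Longrightarrow> j < 17 \<Longrightarrow> launch_pos ! k = launch_pos ! j \<Longrightarrow> k = j"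
proof -
  have "distinct seed_pos" "length seed_pos = 16" "distinct launch_pos" "length launch_pos = 17"
    by (simp_all add: seed_pos_def launch_pos_def)
  then show "k < 16 \<Longrightarrow> j < 16 \<Longrightarrow> seed_pos ! k = seed_pos ! j \<Longrightarrow> k = j"
    "k < 17 \<Longrightarrow> j < 17 \<Longrightarrow> launch_pos ! k = launch_pos ! j \<Longrightarrow> k = j"
    by (auto simp: nth_eq_iff_index_eq)
qed

text \<open>The last clause sharpens the strip of tower 0 above the seed level, where the last
  launched tower and the end of the ramp come close.\<close>

lemma home_bounds:
  assumes "(I, k) \<in> nodes" "home I = Some t"
  shows "t \<le> J" "fst (place I k) \<in> {base_x t - 3..base_x t + 3}" "base_y t - 2 \<le> snd (place I k)"
    "snd (place I k) \<le> base_y t + int M + 1"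
    "t = 0 \<Longrightarrow> 0 < snd (place I k) \<Longrightarrow> wall \<le> fst (place I k)"
proof -
  have k: "present I" "k < len (fam_of I)"
    using assms(1) size_of_le[of I] by (auto simp: nodes_def)
  show "t \<le> J" using k assms(2) J_pos by (cases I) auto
  have *: "fst (place I k) \<in> {base_x t - 3..base_x t + 3} \<and> base_y t - 2 \<le> snd (place I k) \<and>
    snd (place I k) \<le> base_y t + int M + 1 \<and>
    (t = 0 \<longrightarrow> 0 < snd (place I k) \<longrightarrow> wall \<le> fst (place I k))"
    using k assms(2) seed_pos_bounds(1,2)[of k] launch_pos_bounds(1,2)[of k]
    by (cases I) (auto simp: side_def wall_def base_x_def base_y_simps)
  then show "fst (place I k) \<in> {base_x t - 3..base_x t + 3}" "base_y t - 2 \<le> snd (place I k)"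
    "snd (place I k) \<le> base_y t + int M + 1"
    "t = 0 \<Longrightarrow> 0 < snd (place I k) \<Longrightarrow> wall \<le> fst (place I k)"
    by auto
qed

lemma home_cases:
  assumes "(I, k) \<in> nodes" "home I = Some t" "place I k = (x, y)"
  obtains (entry) "I = (case t of 0 \<Rightarrow> I_Seed | Suc i \<Rightarrow> I_Launch i)" "y \<le> base_y t"
        "x \<noteq> base_x t \<or> y \<noteq> base_y t" "t = 0 \<Longrightarrow> x \<noteq> base_x t + 3 * side t \<or> y \<noteq> base_y t"
    | (joint) "I = I_Joint t" "k = 0" "x = base_x t" "y = base_y t"
    | (up) "I = I_Up t" "x = base_x t" "y = base_y t + 1 + int k" "k < M"
    | (arch) "I = I_Arch t" "x = base_x t + side t * int k" "y = base_y t + 1 + int M" "k < 4"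
    | (down) "I = I_Down t" "x = base_x t + 3 * side t" "y = base_y t + int M - int k" "k < M"
    | (turn) "I = I_Turn" "t = 0" "k = 0" "x = base_x t + 3 * side t" "y = base_y t"
proof -
  have k: "k < len (fam_of I)"
    using assms(1) size_of_le[of I] by (auto simp: nodes_def)
  show thesis
  proof (cases I)
    case I_Seed
    with k have "k < 16" by simp
    from seed_pos_bounds[OF this] I_Seed assms(2,3) show thesis
      by (intro entry) (auto simp: base_x_def base_y_simps side_def)
  next
    case (I_Launch i)
    with k have "k < 17" by simp
    from launch_pos_bounds[OF this] I_Launch assms(2,3) show thesis
      by (intro entry) (auto simp: base_x_def base_y_simps prod_eq_iff)
  next
    case I_Turn
    with k assms(2,3) show thesis
      by (intro turn) (auto simp: base_x_def base_y_simps)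
  qed (use k assms(2,3) joint up arch down in auto)
qed

lemma home_inj:
  assumes "(I, k) \<in> nodes" "home I = Some t" "(K, j) \<in> nodes" "home K = Some t"
    and eq: "place I k = place K j"
  shows "I = K \<and> k = j"
proof -
  have len: "k < len (fam_of I)" "j < len (fam_of K)"
    using assms(1,3) size_of_le[of I] size_of_le[of K] by (auto simp: nodes_def)
  have s: "side t = 1 \<or> side t = - 1" by (simp add: side_def)
  obtain x y where xy: "place I k = (x, y)" "place K j = (x, y)" using eq by (metis surj_pair)
  have entry: "k = j" if "I = (case t of 0 \<Rightarrow> I_Seed | Suc i \<Rightarrow> I_Launch i)" "K = I"
    using that eq len chain_pos_inj[of k j] by (cases t) (auto simp: prod_eq_iff)
  from assms(1,2) xy(1) show ?thesis
    by (cases rule: home_cases; cases rule: home_cases[OF assms(3,4) xy(2)])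
      (use s entry in auto)
qed

text \<open>Launched towers are seven columns wide and spaced by eight. Only the last of them can
  share columns with tower 0; it starts at height \<open>base_y J - 2 > 0\<close> and stays west of
  the wall, where tower 0 has no tiles at such heights.\<close>

lemma tower_disjoint:
  assumes "(I, k) \<in> nodes" "home I = Some t" "(K, j) \<in> nodes" "home K = Some s"
    and eq: "place I k = place K j"
  shows "t = s"
proof -
  have no_zero: False if "(I, k) \<in> nodes" "home I = Some 0" "(K, j) \<in> nodes" "home K = Some (Suc i)"
    "place I k = place K j" for I K k j i
  proof -
    note b0 = home_bounds[OF that(1,2)] and b1 = home_bounds[OF that(3,4)]
    have i: "Suc i \<le> J" by (rule b1)
    have w: "wall = -3 \<or> wall = 0" by (simp add: wall_def)
    have x: "fst (place K j) \<le> wall + 8 * int (Suc i) - 8 * int J - 1" "-3 \<le> fst (place K j)"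
      using b0(2) b1(2) that(5) by (auto simp: base_x_def)
    then have "Suc i = J" using i w by auto
    then have "0 < snd (place K j)" using b1(3) base_y_simps(4) by auto
    then have "wall \<le> fst (place K j)" using b0(5) that(5) by simp
    then show False using x(1) i by simp
  qed
  have no_suc: "i = i'" if "(I, k) \<in> nodes" "home I = Some (Suc i)" "(K, j) \<in> nodes"
    "home K = Some (Suc i')" "place I k = place K j" for I K k j i i'
  proof -
    have "\<bar>8 * int i - 8 * int i'\<bar> \<le> 6"
      using home_bounds(2)[OF that(1,2)] home_bounds(2)[OF that(3,4)] that(5)
      by (auto simp: base_x_def)
    then show ?thesis by presburger
  qed
  show ?thesis
  proof (cases t)
    case 0
    then show ?thesis using no_zero[of I k K j "s - 1"] assms by (cases s) auto
  next
    case (Suc i)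
    then show ?thesis
      using no_zero[of K j I k i] no_suc[of I k i K j "s - 1"] assms by (cases s) auto
  qed
qed

text \<open>Without its omitted tile the ramp stops just before the wall. Only the flat part of the
  last period comes within eight columns of it, at height \<open>base_y J - 3 > 0\<close>.\<close>

lemma ramp_bounds:
  assumes "(I_Ramp i, k) \<in> nodes" "place (I_Ramp i) k = (x, y)"
  shows "-2 \<le> y" and "x < wall" and "wall - 8 < x \<Longrightarrow> 0 < y"
proof -
  have k: "i < J" "k < P + 8" "i = J - 1 \<Longrightarrow> k < P + 7"
    using assms by (auto simp: nodes_def size_of_def split: if_splits)
  show "x < wall"
    using k assms(2) by (cases "i = J - 1") (auto split: if_splits)
  show "-2 \<le> y"
    using P_pos assms(2) base_y_simps(3)[of i] by (auto simp: base_y_simps(2) split: if_splits)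
  show "0 < y" if "wall - 8 < x"
  proof -
    have "P \<le> k" "Suc i = J" using that k assms(2) by (auto split: if_splits)
    then show ?thesis using base_y_simps(4) assms(2) by auto
  qed
qed

lemma exit_bounds:
  assumes "(I_Exit, k) \<in> nodes" "place I_Exit k = (x, y)"
  shows "-3 \<le> y" "y \<le> 0" "wall - 1 \<le> x" "x \<le> 4"
    "west 0 \<Longrightarrow> x = -4" "\<not> west 0 \<Longrightarrow> x = 4 \<or> y = -3"
  using assms by (auto simp: nodes_def size_of_def wall_def split: if_splits)

lemma ramp_cases:
  assumes "(I_Ramp i, k) \<in> nodes" "place (I_Ramp i) k = (x, y)"
  obtains (rise) "x = wall + 8 * int i - 8 * int J" "y = base_y i - 2 + int k" "k < P"
    | (flat) m where "k = P + m" "m < 8" "x = wall + 8 * int i - 8 * int J + int m + 1"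
        "y = base_y (Suc i) - 3"
proof (cases "k < P")
  case True
  then show thesis using rise assms by simp
next
  case False
  then have "k = P + (k - P)" "k - P < 8"
    using assms(1) by (auto simp: nodes_def size_of_def split: if_splits)
  then show thesis using flat[of "k - P"] False assms(2) by simp
qed

text \<open>The run keeps to row \<open>-3\<close>, below the ramp and west of the exit; the exit
  stays at or below row 0, in columns where the ramp is above row 0. Ramp tiles are told apart by
  their columns modulo 8.\<close>

lemma exit_run_ramp_inj:
  assumes "(I, k) \<in> nodes" "home I = None" "(K, j) \<in> nodes" "home K = None"
    and eq: "place I k = place K j"
  shows "I = K \<and> k = j"
proof -
  have exit_run: False if "(I_Exit, k) \<in> nodes" "place I_Exit k = place I_Run j" for k j
    using exit_bounds[OF that(1), of "wall - 2 - int j" "-3"] that(2) by simp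
  have exit_ramp: False
    if "(I_Exit, k) \<in> nodes" "(I_Ramp i, j) \<in> nodes" "place I_Exit k = place (I_Ramp i) j" for k i j
  proof -
    obtain x y where xy: "place I_Exit k = (x, y)" by force
    with that(3) have "place (I_Ramp i) j = (x, y)" by metis
    from exit_bounds[OF that(1) xy] ramp_bounds(2,3)[OF that(2) this] show False by linarith
  qed
  have run_ramp: False
    if "(I_Ramp i, j) \<in> nodes" "place I_Run k = place (I_Ramp i) j" for k i j
    using ramp_bounds(1)[OF that(1), of "wall - 2 - int k" "-3"] that(2) by simp
  have ramp_ramp: "i = i' \<and> k = j"
    if n: "(I_Ramp i, k) \<in> nodes" "(I_Ramp i', j) \<in> nodes"
      and same: "place (I_Ramp i) k = place (I_Ramp i') j"
    for i i' k j
  proof -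
    obtain x y where xy: "place (I_Ramp i) k = (x, y)" "place (I_Ramp i') j = (x, y)"
      using same by (metis surj_pair)
    from n(1) xy(1) show ?thesis
    proof (cases rule: ramp_cases)
      case rise
      note first = this
      from n(2) xy(2) show ?thesis
      proof (cases rule: ramp_cases)
        case rise
        have "i = i'" using first(1) rise(1) by simp
        with first rise show ?thesis by simp
      next
        case (flat m)
        have "8 * i = 8 * i' + m + 1" using first(1) flat(3) by linarith
        \<comment> \<open>The eighth flat tile alone shares its column with a rise, that of the next
          period, which starts one row higher.\<close>
        then have "i = Suc i'" using flat(2) by presburger
        with first flat show ?thesis by (simp add: base_y_simps)
      qed
    next
      case (flat m)
      note first = this
      from n(2) xy(2) show ?thesis
      proof (cases rule: ramp_cases)
        case rise
        have "8 * i' = 8 * i + m + 1" using first(3) rise(1) by linarith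
        then have "i' = Suc i" using first(2) by presburger
        with first rise show ?thesis by (simp add: base_y_simps)
      next
        case (flat n)
        have "8 * i + m = 8 * i' + n" using first(3) flat(3) by linarith
        then have "i = i' \<and> m = n" using first(2) flat(2) by presburger
        with first flat show ?thesis by simp
      qed
    qed
  qed
  have exit_exit: "k = j" if "place I_Exit k = place I_Exit j" for k j
    using that by (auto split: if_splits)
  have run_run: "k = j" if "place I_Run k = place I_Run j" for k j
    using that by simp
  have shape: "I = I_Exit \<or> I = I_Run \<or> (\<exists>i. I = I_Ramp i)" if "home I = None" for I
    using that by (cases I) auto
  note facts = assms(1,3) eq eq[symmetric]
  from shape[OF assms(2)] shape[OF assms(4)] show ?thesis
    by (elim disjE exE; use facts exit_exit exit_run exit_ramp run_run run_ramp ramp_ramp in blast)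
qed

text \<open>The rises use the columns between the strips of launched towers. A flat part crosses the
  strip of the tower it launches in row \<open>base_y (Suc i) - 3\<close>, one row below the lowest
  tile of that tower.\<close>

lemma home_disjoint:
  assumes "(I, k) \<in> nodes" "home I = Some t" "(K, j) \<in> nodes" "home K = None"
  shows "place I k \<noteq> place K j"
proof
  assume eq: "place I k = place K j"
  obtain x y where xy: "place I k = (x, y)" "place K j = (x, y)" using eq by (metis surj_pair)
  note h = home_bounds[OF assms(1,2)]
  have w: "wall = -3 \<or> wall = 0" "west 0 \<longleftrightarrow> wall = -3" by (auto simp: wall_def)
  have t0: "t = 0 \<Longrightarrow> -3 \<le> x \<and> x \<le> 3 \<and> -2 \<le> y \<and> (0 < y \<longrightarrow> wall \<le> x)"
    using h(2,3,5) xy by (auto simp: base_x_def base_y_simps)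
  have tS: "wall + 8 * int t - 8 * int J - 7 \<le> x \<and> x \<le> wall + 8 * int t - 8 * int J - 1 \<and>
      base_y t - 2 \<le> y \<and> int P - 2 \<le> y" if "t \<noteq> 0"
    using h(2,3) xy that base_y_mono[of 1 t] by (auto simp: base_x_def base_y_def)
  have top: "t = J \<Longrightarrow> 3 \<le> y" using tS J_pos base_y_simps(4) by fastforce
  have x_le: "t \<noteq> 0 \<Longrightarrow> x \<le> wall - 1" using tS h(1) by auto
  have t_top: "t = J" if "t \<noteq> 0" "wall - 8 < x" using tS[OF that(1)] h(1) that(2) by auto
  show False
  proof (cases K)
    case I_Exit
    with assms(3) have "(I_Exit, j) \<in> nodes" by simp
    then have e: "-3 \<le> y" "y \<le> 0" "wall - 1 \<le> x" "x \<le> 4" "west 0 \<Longrightarrow> x = -4"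
        "\<not> west 0 \<Longrightarrow> x = 4 \<or> y = -3"
      using exit_bounds[of j x y] xy(2) unfolding I_Exit by blast+
    show False
    proof (cases "t = 0")
      case True
      with t0 e w show False by linarith
    next
      case False
      with t_top e top show False by linarith
    qed
  next
    case I_Run
    then show False using xy(2) t0 tS P_pos by (cases "t = 0") simp_all
  next
    case (I_Ramp i)
    with assms(3) have n: "(I_Ramp i, j) \<in> nodes" by simp
    have p: "place (I_Ramp i) j = (x, y)" using xy(2) unfolding I_Ramp .
    note r = ramp_bounds[OF n p]
    show False
    proof (cases "t = 0")
      case True
      with t0 r(2,3) w(1) show False by auto
    next
      case False
      note tower = tS[OF False]
      from n p show False
      proof (cases rule: ramp_cases)
        case rise
        then show False using tower by presburger
      next
        case (flat m)
        then have "t = Suc i" using tower by presburger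
        then show False using tower flat(4) by simp
      qed
    qed
  qed (use assms(4) in auto)
qed

lemma inj_on_pos_of: "inj_on pos_of nodes"
proof (rule inj_onI, clarify)
  fix I k K j
  assume n: "(I, k) \<in> nodes" "(K, j) \<in> nodes" and "pos_of (I, k) = pos_of (K, j)"
  then have eq: "place I k = place K j" by (simp add: pos_of_def)
  show "I = K \<and> k = j"
  proof (cases "home I"; cases "home K")
    assume "home I = None" "home K = None"
    then show ?thesis using exit_run_ramp_inj n eq by blast
  next
    fix s t assume h: "home I = Some s" "home K = Some t"
    then have "s = t" using tower_disjoint n eq by blast
    then show ?thesis using home_inj n eq h by blast
  next
    fix t assume "home I = None" "home K = Some t"
    then show ?thesis using home_disjoint n eq by metis
  next
    fix t assume "home I = Some t" "home K = None"
    then show ?thesis using home_disjoint n eq by metis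
  qed
qed

section \<open>Growth\<close>

lemma finite_nodes: "finite nodes"
proof -
  have "nodes \<subseteq> (\<Union>I\<in>Collect present. {I} \<times> {..<size_of I})"
    by (auto simp: nodes_def)
  moreover have "Collect present \<subseteq> {I_Seed, I_Turn, I_Exit, I_Run} \<union> I_Launch ` {..J} \<union> I_Joint ` {..J}
      \<union> I_Up ` {..J} \<union> I_Arch ` {..J} \<union> I_Down ` {..J} \<union> I_Ramp ` {..J}"
  proof
    fix I assume "I \<in> Collect present"
    then show "I \<in> {I_Seed, I_Turn, I_Exit, I_Run} \<union> I_Launch ` {..J} \<union> I_Joint ` {..J}
      \<union> I_Up ` {..J} \<union> I_Arch ` {..J} \<union> I_Down ` {..J} \<union> I_Ramp ` {..J}"
      by (cases I) auto
  qed
  then have "finite (Collect present)" by (rule finite_subset) auto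
  ultimately show ?thesis by (auto intro: finite_subset)
qed

definition represents :: "node set \<Rightarrow> assembly \<Rightarrow> bool" where
  "represents A \<beta> \<longleftrightarrow> closed A \<and> dom \<beta> = pos_of ` A \<and>
     (\<forall>v\<in>A. \<beta> (pos_of v) = Some (tile_of (label_of v)))"

definition seed_assembly :: assembly where
  "seed_assembly = [(3, -1) \<mapsto> tile_of (Seed_Chain, 0)]"

lemma represents_seed: "represents {root} seed_assembly"
  by (auto simp: represents_def closed_def seed_assembly_def root_def nodes_def size_of_def
      pos_of_def seed_pos_def label_of_def)

text \<open>Agreement of the assembly with the guess \<open>west\<close>. It passes from an assembly
  to all of its restrictions, so requiring it of the limit suffices for every stage.\<close>

definition arches_match :: "assembly \<Rightarrow> bool" where
  "arches_match \<beta> \<longleftrightarrow> (\<forall>t\<le>J. \<forall>l\<in>{(Arch, 0), (Arch, 3)}.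
     \<beta> (top t) = Some (tile_of l) \<longrightarrow> l = label_of (I_Arch t, 0))"

lemma attachable_represents:
  assumes "represents A \<beta>"
  shows "attachable (tile_of ` labels) \<beta> p t \<longleftrightarrow> p \<notin> pos_of ` A \<and>
    (\<exists>v\<in>A. \<exists>d. \<exists>l\<in>labels. p = shift d (pos_of v) \<and> t = tile_of l \<and> bond (label_of v) d l)"
proof -
  have "dom \<beta> = pos_of ` A" using assms by (simp add: represents_def)
  then have dom: "\<beta> p = None \<longleftrightarrow> p \<notin> pos_of ` A" for p
    by (metis domIff)
  show ?thesis
  proof
    assume att: "attachable (tile_of ` labels) \<beta> p t"
    then have free: "p \<notin> pos_of ` A" unfolding attachable_def dom by blast
    from att obtain q u l where q: "\<beta> q = Some u" "interacts p t q u" and l: "l \<in> labels" "t = tile_of l"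
      unfolding attachable_def by blast
    have "q \<in> pos_of ` A" using q(1) dom[of q] by (cases "q \<in> pos_of ` A") simp_all
    then obtain v where v: "v \<in> A" "q = pos_of v" by blast
    have "\<beta> q = Some (tile_of (label_of v))" using assms v unfolding represents_def by blast
    then have "u = tile_of (label_of v)" using q(1) by simp
    then obtain d where "pos_of v = shift d p" "bond l d (label_of v)"
      using q(2) l(2) v(2) interacts_tile_of_iff by blast
    then have "p = shift (opp d) (pos_of v)" "bond (label_of v) (opp d) l"
      using bond_sym by auto
    then show "p \<notin> pos_of ` A \<and> (\<exists>v\<in>A. \<exists>d. \<exists>l\<in>labels.
        p = shift d (pos_of v) \<and> t = tile_of l \<and> bond (label_of v) d l)"
      using free v(1) l by blast
  next
    assume "p \<notin> pos_of ` A \<and> (\<exists>v\<in>A. \<exists>d. \<exists>l\<in>labels.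
        p = shift d (pos_of v) \<and> t = tile_of l \<and> bond (label_of v) d l)"
    then obtain v d l where p: "p \<notin> pos_of ` A" and v: "v \<in> A" and l: "l \<in> labels"
      and eq: "p = shift d (pos_of v)" "t = tile_of l" and bond: "bond (label_of v) d l"
      by blast
    have "pos_of v = shift (opp d) p" using eq(1) by simp
    then have "interacts p t (pos_of v) (tile_of (label_of v))"
      using bond_sym[OF bond] eq(2) interacts_tile_of_iff by blast
    moreover have "\<beta> (pos_of v) = Some (tile_of (label_of v))"
      using assms v unfolding represents_def by blast
    ultimately show "attachable (tile_of ` labels) \<beta> p t"
      unfolding attachable_def dom using p l eq(2) by blast
  qed
qed

lemma represents_step:
  assumes A: "represents A \<beta>" and step: "step (tile_of ` labels) \<beta> \<beta>'" and match: "arches_match \<beta>'"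
  shows "\<exists>B. represents B \<beta>'"
proof -
  obtain v d l where p: "shift d (pos_of v) \<notin> pos_of ` A" and v: "v \<in> A" and l: "l \<in> labels"
    and bond: "bond (label_of v) d l" and \<beta>': "\<beta>' = \<beta>(shift d (pos_of v) \<mapsto> tile_of l)"
    using step unfolding step_def attachable_represents[OF A] by blast
  have closed: "closed A" using A by (simp add: represents_def)
  have choice: "l = label_of (I_Arch t, 0)"
    if "t \<le> J" "shift d (pos_of v) = top t" "l \<in> {(Arch, 0), (Arch, 3)}" for t
  proof -
    have "\<beta>' (top t) = Some (tile_of l)" unfolding \<beta>' that(2) by simp
    then show ?thesis using match that(1,3) unfolding arches_match_def by blast
  qed
  obtain u where u: "u \<in> nodes" "u \<noteq> root" "parent u = v" "pos_of u = shift d (pos_of v)" "label_of u = l"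
    using new_tile_is_child[OF closed v l bond p choice] by blast
  have \<beta>': "\<beta>' = \<beta>(pos_of u \<mapsto> tile_of (label_of u))" using \<beta>' u(4,5) by simp
  have fresh: "pos_of w \<noteq> pos_of u" if "w \<in> A" for w using p u(4) that by (metis image_eqI)
  have "closed (insert u A)" using closed u(1,3) v unfolding closed_def by blast
  moreover have "dom \<beta>' = pos_of ` insert u A" using A unfolding represents_def \<beta>' by simp
  moreover have "\<beta>' (pos_of w) = Some (tile_of (label_of w))" if "w \<in> insert u A" for w
  proof (cases "w = u")
    case False
    then show ?thesis using that fresh A unfolding represents_def \<beta>' by simp
  qed (simp add: \<beta>')
  ultimately show ?thesis unfolding represents_def by blast
qed

text \<open>Infinite assembly sequences are covered because a union of closed sets is closed: the
  limit is represented by the union over all stages.\<close>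

lemma producible_represents:
  assumes "producible (tile_of ` labels) seed_assembly \<alpha>" and match: "arches_match \<alpha>"
  shows "\<exists>A. represents A \<alpha>"
proof -
  obtain f where f0: "f 0 = seed_assembly"
    and fS: "\<And>i. f (Suc i) = f i \<or> step (tile_of ` labels) (f i) (f (Suc i))"
    and none: "\<And>p. \<alpha> p = None \<longleftrightarrow> (\<forall>i. f i p = None)"
    and some: "\<And>i p t. f i p = Some t \<Longrightarrow> \<alpha> p = Some t"
    using assms(1) unfolding producible_def by blast
  have match_f: "arches_match (f i)" for i
    using match some unfolding arches_match_def by blast
  have "\<exists>A. represents A (f i)" for i
  proof (induction i)
    case 0
    show ?case using f0 represents_seed by auto
  next
    case (Suc i)
    then obtain A where "represents A (f i)" by blast
    then show ?case using fS[of i] represents_step[OF _ _ match_f[of "Suc i"]] by auto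
  qed
  then obtain A where A: "\<And>i. represents (A i) (f i)" by metis
  have "dom \<alpha> = (\<Union>i. dom (f i))"
  proof (rule set_eqI)
    fix p
    have "p \<in> dom \<alpha> \<longleftrightarrow> \<not> (\<forall>i. f i p = None)" using none[of p] by (simp only: domIff simp_thms)
    then show "p \<in> dom \<alpha> \<longleftrightarrow> p \<in> (\<Union>i. dom (f i))"
      by (simp only: domIff UN_iff not_all bex_UNIV)
  qed
  also have "\<dots> = pos_of ` (\<Union>i. A i)" using A by (auto simp: represents_def)
  finally have "dom \<alpha> = pos_of ` (\<Union>i. A i)" .
  moreover have "closed (\<Union>i. A i)" using A unfolding represents_def closed_def by blast
  moreover have "\<alpha> (pos_of v) = Some (tile_of (label_of v))" if "v \<in> (\<Union>i. A i)" for v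
  proof -
    obtain i where "v \<in> A i" using \<open>v \<in> (\<Union>i. A i)\<close> by blast
    then have "f i (pos_of v) = Some (tile_of (label_of v))"
      using A[of i] unfolding represents_def by blast
    then show ?thesis by (rule some)
  qed
  ultimately show ?thesis unfolding represents_def by blast
qed

lemma producible_seed:
  assumes "producible T \<sigma> \<alpha>" "\<sigma> p = Some t"
  shows "\<alpha> p = Some t"
proof -
  from assms(1) obtain f :: "nat \<Rightarrow> assembly" where "f 0 = \<sigma>"
    and f: "\<forall>p. (\<alpha> p = None \<longleftrightarrow> (\<forall>i. f i p = None)) \<and> (\<forall>i t. f i p = Some t \<longrightarrow> \<alpha> p = Some t)"
    unfolding producible_def by blast
  then have "f 0 p = Some t" using assms(2) by simp
  then show ?thesis using f by blast
qed

text \<open>If the parent of a node is placed, the node could attach unless its cell is taken.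
  Terminality thus makes the cell taken, and induction along the tree yields all nodes.\<close>

lemma terminal_represents_nodes:
  assumes "terminal (tile_of ` labels) seed_assembly \<alpha>" and "arches_match \<alpha>"
  shows "represents nodes \<alpha>"
proof -
  have prod: "producible (tile_of ` labels) seed_assembly \<alpha>"
    using assms(1) unfolding terminal_def by blast
  then obtain A where A: "represents A \<alpha>"
    using assms(2) producible_represents by blast
  have closed: "closed A" and dom: "dom \<alpha> = pos_of ` A" using A by (auto simp: represents_def)
  \<comment> \<open>By injectivity of \<open>pos_of\<close>, only the node itself can occupy its
    cell, so no part of the structure obstructs another.\<close>
  have in_A: "v \<in> A" if "v \<in> nodes" "pos_of v \<in> pos_of ` A" for v
  proof -
    have "A \<subseteq> nodes" using closed unfolding closed_def by blast
    from inj_on_image_mem_iff[OF inj_on_pos_of that(1) this] that(2) show ?thesis by blast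
  qed
  have "\<alpha> (3, -1) = Some (tile_of (Seed_Chain, 0))"
    using producible_seed[OF prod] unfolding seed_assembly_def by simp
  then have "(3, -1) \<in> pos_of ` A" unfolding dom[symmetric] by (rule domI)
  moreover have "pos_of root = (3, -1)" by (simp add: root_def pos_of_def seed_pos_def)
  ultimately have "pos_of root \<in> pos_of ` A" by simp
  moreover have root: "root \<in> nodes" by (simp add: nodes_def root_def size_of_def)
  ultimately have "root \<in> A" using in_A by blast
  moreover have "v \<in> A" if v: "v \<in> nodes" "v \<noteq> root" "parent v \<in> A" for v
  proof -
    obtain d where "pos_of v = shift d (pos_of (parent v))" "bond (label_of (parent v)) d (label_of v)"
      using parent_bond[OF v(1,2)] by blast
    then have "pos_of v \<in> pos_of ` A"
      using assms(1) v(3) label_of_in_labels[OF v(1)]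
      unfolding terminal_def attachable_represents[OF A] by blast
    then show "v \<in> A" using in_A v(1) by blast
  qed
  ultimately have "nodes \<subseteq> A" by (rule nodes_induct)
  then have "A = nodes" using closed by (auto simp: closed_def)
  then show ?thesis using A by simp
qed

text \<open>The bottom row \<open>-3\<close> contains the run, the top row
  \<open>J * P + M + 1\<close> the arch of tower \<open>J\<close>.\<close>

lemma height_eq:
  assumes "represents nodes \<alpha>"
  shows "finite (dom \<alpha>)" and "height \<alpha> = int (J * P + M + 5)"
proof -
  have dom: "dom \<alpha> = pos_of ` nodes" using assms by (simp add: represents_def)
  then show fin: "finite (dom \<alpha>)" using finite_nodes by simp
  have base_y_J: "base_y J = int J * int P" by (simp add: base_y_def)
  have bounds: "-3 \<le> snd (pos_of (I, k)) \<and> snd (pos_of (I, k)) \<le> int J * int P + M + 1"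
    if "(I, k) \<in> nodes" for I k
  proof (cases "home I")
    case (Some t)
    note b = home_bounds[OF that Some]
    show ?thesis
      using b(3,4) base_y_mono[OF b(1)] base_y_simps(3)[of t] base_y_J
      unfolding pos_of_def fst_conv snd_conv by linarith
  next
    case None
    show ?thesis
    proof (cases "\<exists>i. I = I_Ramp i")
      case True
      then obtain i where I: "I = I_Ramp i" by blast
      obtain x y where xy: "place (I_Ramp i) k = (x, y)" by force
      have n: "(I_Ramp i, k) \<in> nodes" using that I by simp
      have "Suc i \<le> J" using n by (simp add: nodes_def)
      then have "base_y i + int P \<le> int J * int P"
        using base_y_mono[of "Suc i" J] by (simp add: base_y_simps(2)) (simp add: base_y_def)
      then have "y \<le> int J * int P + M + 1"
        by (cases rule: ramp_cases[OF n xy]) (auto simp: base_y_simps(2))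
      then show ?thesis using ramp_bounds(1)[OF n xy] xy I by (simp add: pos_of_def)
    next
      case False
      have nonneg: "0 \<le> int J * int P" by simp
      obtain x y where xy: "place I k = (x, y)" by force
      have "I = I_Exit \<or> I = I_Run" using False None by (cases I) auto
      then have "-3 \<le> y \<and> y \<le> 0" using exit_bounds(1,2)[of k x y] that xy by auto
      moreover have "snd (pos_of (I, k)) = y" by (simp add: pos_of_def xy)
      ultimately show ?thesis using nonneg by linarith
    qed
  qed
  have bottom: "(I_Run, 0) \<in> nodes" "snd (pos_of (I_Run, 0)) = -3"
    using J_pos by (auto simp: nodes_def size_of_def pos_of_def)
  have "Max (snd ` dom \<alpha>) = int J * int P + M + 1"
  proof (rule Max_eqI)
    have "(I_Arch J, 0) \<in> nodes" "snd (pos_of (I_Arch J, 0)) = int J * int P + M + 1"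
      by (auto simp: nodes_def size_of_def pos_of_def base_y_def)
    then show "int J * int P + M + 1 \<in> snd ` dom \<alpha>" unfolding dom by (metis image_eqI)
  qed (use fin bounds dom in auto)
  moreover have "Min (snd ` dom \<alpha>) = -3"
  proof (rule Min_eqI)
    show "-3 \<in> snd ` dom \<alpha>" using bottom unfolding dom by (metis image_eqI)
  qed (use fin bounds dom in auto)
  ultimately show "height \<alpha> = int (J * P + M + 5)" by (simp add: height_def)
qed

end

section \<open>The theorem\<close>

text \<open>The systems for small \<open>n\<close>: tiles differ in their north glues, but all south
  glues are null, so the seed is already terminal.\<close>

lemma inert_tiles:
  assumes "1 \<le> n"
  defines "T \<equiv> (\<lambda>i. Tile (Suc i) 0 0 0) ` {..<n}" and "\<sigma> \<equiv> [(0, 0) \<mapsto> Tile 1 0 0 0]"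
  shows "finite T" "card T = n" "single_tile_seed T \<sigma>"
    and "terminal T \<sigma> \<alpha> \<Longrightarrow> finite (dom \<alpha>) \<and> height \<alpha> = 1"
proof -
  show "finite T" by (simp add: T_def)
  show "card T = n" unfolding T_def by (subst card_image) (auto simp: inj_on_def)
  have mem: "Tile 1 0 0 0 \<in> T" unfolding T_def using assms(1) by (intro image_eqI[of _ _ 0]) auto
  then show "single_tile_seed T \<sigma>" unfolding single_tile_seed_def \<sigma>_def by blast
  have stuck: "\<not> step T \<sigma> \<beta>" for \<beta>
  proof
    assume "step T \<sigma> \<beta>"
    then obtain p t q u where "t \<in> T" "\<sigma> q = Some u" "interacts p t q u"
      unfolding step_def attachable_def by blast
    then show False by (auto simp: T_def \<sigma>_def interacts_def split: if_splits)
  qed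
  assume "terminal T \<sigma> \<alpha>"
  then obtain f :: "nat \<Rightarrow> assembly" where f: "f 0 = \<sigma>" "\<And>i. f (Suc i) = f i \<or> step T (f i) (f (Suc i))"
    and lim: "\<forall>p. (\<alpha> p = None \<longleftrightarrow> (\<forall>i. f i p = None)) \<and> (\<forall>i t. f i p = Some t \<longrightarrow> \<alpha> p = Some t)"
    unfolding terminal_def producible_def by blast
  have fi: "f i = \<sigma>" for i
  proof (induction i)
    case (Suc i)
    then show ?case using f(2)[of i] stuck by auto
  qed (rule f(1))
  have "\<alpha> p = None \<longleftrightarrow> \<sigma> p = None" for p
    using lim[rule_format, of p] unfolding fi by blast
  then have "dom \<alpha> = dom \<sigma>" by (simp add: dom_def)
  then have "dom \<alpha> = {(0, 0)}" by (simp add: \<sigma>_def)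
  then show "finite (dom \<alpha>) \<and> height \<alpha> = 1" by (simp add: height_def)
qed

lemma (in towers) tower_system:
  defines "T \<equiv> tile_of ` labels" and "\<sigma> \<equiv> [(3, -1) \<mapsto> tile_of (Seed_Chain, 0)]"
  shows "finite T" "card T = 58 + M + 8 * J + P" "single_tile_seed T \<sigma>"
    and "terminal T \<sigma> \<alpha> \<Longrightarrow> finite (dom \<alpha>) \<and> height \<alpha> = int (J * P + M + 5)"
proof -
  show "finite T" by (simp add: T_def finite_labels)
  show "card T = 58 + M + 8 * J + P"
    by (simp add: T_def card_image inj_on_tile_of card_labels)
  have "(Seed_Chain, 0) \<in> labels" by (simp add: labels_def)
  then show "single_tile_seed T \<sigma>" unfolding single_tile_seed_def T_def \<sigma>_def by blast
  assume \<alpha>: "terminal T \<sigma> \<alpha>"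
  define west_at where "west_at x y \<longleftrightarrow> \<alpha> (x, y + 1 + int M) = Some (tile_of (Arch, 0))" for x y
  \<comment> \<open>The arch of tower 0 is read first, since it fixes \<open>wall\<close> and with
    it the column of every other tower. A missing or different tile counts as east.\<close>
  define west where "west t \<longleftrightarrow> (if t = 0 then west_at 0 0
    else west_at ((if west_at 0 0 then -3 else 0) + 8 * int t - 8 * int J - 4) (int t * int P))" for t
  interpret growth M P J west by unfold_locales
  have west_iff: "west t \<longleftrightarrow> \<alpha> (top t) = Some (tile_of (Arch, 0))" for t
    by (simp add: west_def west_at_def top_def base_x_def base_y_def wall_def)
  \<comment> \<open>Distinctness of the two end tiles is what makes the value of \<open>west\<close>
    unambiguous.\<close>
  have "tile_of (Arch, 0) \<noteq> tile_of (Arch, 3)"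
    using inj_onD[OF inj_on_tile_of, of "(Arch, 0)" "(Arch, 3)"] by (auto simp: labels_def)
  then have "arches_match \<alpha>"
    unfolding arches_match_def by (auto simp: label_of_def west_iff)
  moreover have "terminal (tile_of ` labels) seed_assembly \<alpha>"
    using \<alpha> by (simp add: T_def \<sigma>_def seed_assembly_def)
  ultimately show "finite (dom \<alpha>) \<and> height \<alpha> = int (J * P + M + 5)"
    using height_eq terminal_represents_nodes by blast
qed

theorem mainTheorem2:
  shows "\<exists>(Ts :: nat \<Rightarrow> tile set) (\<sigma>s :: nat \<Rightarrow> assembly) (h :: nat \<Rightarrow> int).
     (\<lambda>n. real_of_int (h n) - 2 * real n) \<in> o(\<lambda>n. real n) \<and>
     (\<forall>n\<ge>1. finite (Ts n) \<and> card (Ts n) = n \<and> single_tile_seed (Ts n) (\<sigma>s n) \<and>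
        (\<forall>\<alpha>. terminal (Ts n) (\<sigma>s n) \<alpha> \<longrightarrow> finite (dom \<alpha>) \<and> height \<alpha> = h n))"
proof -
  \<comment> \<open>With \<open>k = r - 5\<close> and \<open>r \<ge> 35\<close>, that is \<open>n \<ge> 1225\<close>, the tile count leaves a spine of length
    \<open>M = n - 58 - 9 k \<ge> k\<^sup>2 - 3\<close>, tall enough to stop the ramp. Smaller \<open>n\<close> get tiles without bonds.\<close>
  define r where "r n = nat \<lfloor>sqrt (real n)\<rfloor>" for n
  define k where "k n = r n - 5" for n
  \<comment> \<open>The second value is \<open>k n * k n + M + 5\<close> with
    \<open>M = n - 58 - 9 * k n\<close>, from \<open>J = P = k n\<close>.\<close>
  define h where "h n = (if n < 1225 then 1 else int n + int (k n * k n) - int (9 * k n) - 53)" for n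
  have r: "real (r n) \<le> sqrt (real n)" "sqrt (real n) < real (r n) + 1" for n
    by (auto simp: r_def)
  have r_sq: "r n * r n \<le> n" for n
  proof -
    have "real (r n) * real (r n) \<le> sqrt (real n) * sqrt (real n)"
      using r(1) by (intro mult_mono) auto
    then show ?thesis by (simp flip: of_nat_mult)
  qed
  have r_ge: "35 \<le> r n" if "1225 \<le> n" for n
  proof -
    have "35 \<le> sqrt (real n)" using that by (intro real_le_rsqrt) simp
    then show ?thesis using r(2)[of n] by linarith
  qed
  have rk: "r n = k n + 5" "30 \<le> k n" if "1225 \<le> n" for n
    using r_ge[OF that] by (auto simp: k_def)
  have k_le: "k n * k n + 9 * k n + 55 \<le> n" if "1225 \<le> n" for n
  proof -
    have "k n * k n + 10 * k n + 25 \<le> n" using r_sq[of n] rk(1)[OF that] by (simp add: algebra_simps)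
    \<comment> \<open>Here \<open>30 \<le> k n\<close> gives
      \<open>9 * k n + 55 \<le> 10 * k n + 25\<close>, whence the threshold
      \<open>35 * 35 = 1225\<close>.\<close>
    then show ?thesis using rk(2)[OF that] by linarith
  qed
  have "\<exists>T \<sigma>. finite T \<and> card T = n \<and> single_tile_seed T \<sigma> \<and>
      (\<forall>\<alpha>. terminal T \<sigma> \<alpha> \<longrightarrow> finite (dom \<alpha>) \<and> height \<alpha> = h n)" if "1 \<le> n" for n
  proof (cases "n < 1225")
    case True
    then have "h n = 1" by (simp add: h_def)
    then show ?thesis using inert_tiles[OF that] by metis
  next
    case False
    then have n: "1225 \<le> n" by simp
    define M where "M = n - 58 - 9 * k n"
    have M: "M + 58 + 9 * k n = n" "k n * k n \<le> M + 3"
      using k_le[OF n] rk(2)[OF n] mult_le_mono[of 30 "k n" 30 "k n"] by (auto simp: M_def)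
    interpret towers M "k n" "k n"
      using M(2) rk(2)[OF n] mult_le_mono[of 30 "k n" 30 "k n"] by unfold_locales auto
    have "h n = int (k n * k n + M + 5)"
      using False M(1) by (simp add: h_def)
    moreover have "58 + M + 8 * k n + k n = n" using M(1) by simp
    ultimately show ?thesis using tower_system by metis
  qed
  then obtain T \<sigma> where sys: "\<forall>n\<ge>1. finite (T n) \<and> card (T n) = n \<and> single_tile_seed (T n) (\<sigma> n) \<and>
        (\<forall>\<alpha>. terminal (T n) (\<sigma> n) \<alpha> \<longrightarrow> finite (dom \<alpha>) \<and> height \<alpha> = h n)"
    by metis
  \<comment> \<open>With \<open>s = sqrt n\<close> and \<open>k n\<close> between
    \<open>s - 6\<close> and \<open>s - 5\<close>, replacing \<open>k n * k n\<close> by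
    \<open>s * s\<close> costs at most \<open>12 * s\<close> and the linear term at most
    \<open>9 * s\<close>; the remaining \<open>2 * s\<close> absorbs the constants.\<close>
  have bound: "\<bar>real_of_int (h n) - 2 * real n\<bar> \<le> 23 * sqrt (real n)" if n: "1225 \<le> n" for n
  proof -
    define s where "s = sqrt (real n)"
    have s: "s * s = real n" "real (k n) + 5 \<le> s" "s < real (k n) + 6" "35 \<le> s"
      using r[of n] rk[OF n] by (auto simp: s_def)
    have "h n = int n + int (k n * k n) - int (9 * k n) - 53" using n by (simp add: h_def)
    then have h: "real_of_int (h n) = s * s + real (k n) * real (k n) - 9 * real (k n) - 53"
      by (simp add: s(1))
    have "real (k n) * real (k n) \<le> s * s" using s by (intro mult_mono) auto
    moreover have "(s - 6) * (s - 6) \<le> real (k n) * real (k n)" using s by (intro mult_mono) auto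
    moreover have "(s - 6) * (s - 6) = s * s - 12 * s + 36" by (simp add: algebra_simps)
    ultimately have "\<bar>real_of_int (h n) - 2 * (s * s)\<bar> \<le> 23 * s"
      unfolding h using s(2-4) by linarith
    then show ?thesis by (simp add: s(1) flip: s_def)
  qed
  have "(\<lambda>n. real_of_int (h n) - 2 * real n) \<in> O(\<lambda>n. sqrt (real n))"
    using bound by (intro bigoI[of _ 23] eventually_sequentiallyI[of 1225]) auto
  moreover have "(\<lambda>n. sqrt (real n)) \<in> o(\<lambda>n. real n)"
  proof (rule smalloI_tendsto)
    have "(\<lambda>n. inverse (sqrt (real n))) \<longlonglongrightarrow> 0"
      by (intro tendsto_inverse_0_at_top filterlim_compose[OF sqrt_at_top filterlim_real_sequentially])
    moreover have "inverse (sqrt (real n)) = sqrt (real n) / real n" for n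
      by (simp add: sqrt_divide_self_eq)
    ultimately show "(\<lambda>n. sqrt (real n) / real n) \<longlonglongrightarrow> 0" by simp
    show "\<forall>\<^sub>F n in sequentially. real n \<noteq> 0"
      using eventually_gt_at_top[of 0] by eventually_elim simp
  qed
  ultimately have "(\<lambda>n. real_of_int (h n) - 2 * real n) \<in> o(\<lambda>n. real n)"
    by (rule landau_o.big_small_trans)
  with sys show ?thesis by blast
qed

end
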